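(* There exists an isomorphism invariant anti-stochastic graph property $A$ such that $\Pr[\mathbf{G}_n\in A]=(2+o(1))/n^2$ as $n\to\infty$.
   Context: For each $n$, $\mathbf{G}_n$ denotes a graph chosen uniformly at random from all $2^{\binom n2}$ graphs on the vertex set $[n]=\{1,\dots,n\}$. A graph property $A$ is identified with a sequence of sets $A_n$ of graphs on $[n]$; it is isomorphism invariant if for any two isomorphic graphs on $[n]$ either both or neither belong to $A_n$. An adversary is a function $f$ assigning to each graph $G$ on $[n]$ a graph $f(G)$ on $[n]$ such that $G$ and $f(G)$ differ in the adjacency of at most one pair of vertices (i.e. $f(G)$ is $G$, or $G$ with one edge added, or $G$ with one edge deleted). A property $A$ is anti-stochastic if $\Pr[\mathbf{G}_n\in A]=o(1)$ and there is an adversary $f$ such that $\Pr[f(\mathbf{G}_n)\in A]=1-o(1)$, as $n\to\infty$. *)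

theory Defs
  imports "HOL-Probability.Probability" "HOL-Library.Landau_Symbols"
begin

type_synonym graph = "nat set set"

text \<open>
  A simple graph on the vertex set \<open>{1..n}\<close> is represented by its edge set. The vertex set is not
  recorded in the graph, so graph properties and adversaries carry the index \<open>n\<close> explicitly.
\<close>

definition pairs :: "nat \<Rightarrow> nat set set" where
  "pairs n = {e. e \<subseteq> {1..n} \<and> card e = 2}"

definition graphs :: "nat \<Rightarrow> graph set" where
  "graphs n = Pow (pairs n)"

lemma finite_pairs: "finite (pairs n)"
  by (rule finite_subset[of _ "Pow {1..n}"]) (auto simp: pairs_def)

lemma card_pairs: "card (pairs n) = n choose 2"
  using n_subsets[of "{1..n}" 2] by (simp add: pairs_def)

lemma finite_graphs: "finite (graphs n)"
  by (simp add: graphs_def finite_pairs)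

lemma graphs_nonempty: "graphs n \<noteq> {}"
  by (auto simp: graphs_def)

lemma card_graphs: "card (graphs n) = 2 ^ (n choose 2)"
  by (simp add: graphs_def card_Pow finite_pairs card_pairs)

definition random_graph :: "nat \<Rightarrow> graph pmf" where
  "random_graph n = pmf_of_set (graphs n)"

definition isomorphic :: "nat \<Rightarrow> graph \<Rightarrow> graph \<Rightarrow> bool" where
  "isomorphic n G H \<longleftrightarrow>
     (\<exists>\<pi>. bij_betw \<pi> {1..n} {1..n} \<and>
          (\<forall>u\<in>{1..n}. \<forall>v\<in>{1..n}. {u, v} \<in> G \<longleftrightarrow> {\<pi> u, \<pi> v} \<in> H))"

definition graph_property :: "(nat \<Rightarrow> graph set) \<Rightarrow> bool" where
  "graph_property A \<longleftrightarrow> (\<forall>n. A n \<subseteq> graphs n)"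

definition iso_invariant :: "(nat \<Rightarrow> graph set) \<Rightarrow> bool" where
  "iso_invariant A \<longleftrightarrow>
     (\<forall>n. \<forall>G\<in>graphs n. \<forall>H\<in>graphs n. isomorphic n G H \<longrightarrow> (G \<in> A n \<longleftrightarrow> H \<in> A n))"

definition adversary :: "(nat \<Rightarrow> graph \<Rightarrow> graph) \<Rightarrow> bool" where
  "adversary f \<longleftrightarrow>
     (\<forall>n. \<forall>G\<in>graphs n. f n G \<in> graphs n \<and> card ((G - f n G) \<union> (f n G - G)) \<le> 1)"

definition anti_stochastic :: "(nat \<Rightarrow> graph set) \<Rightarrow> bool" where
  "anti_stochastic A \<longleftrightarrow>
     (\<lambda>n. measure_pmf.prob (random_graph n) (A n)) \<in> o(\<lambda>_. 1) \<and>
     (\<exists>f. adversary f \<and>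
          (\<lambda>n. 1 - measure_pmf.prob (random_graph n) {G. f n G \<in> A n}) \<in> o(\<lambda>_. 1))"

end

theory Submission
  imports Defs "HOL-Library.Countable" "HOL-Number_Theory.Totient" "HOL-Number_Theory.Cong"
    "HOL-Real_Asymp.Real_Asymp" "HOL-Analysis.Kronecker_Approximation_Theorem"
begin

text \<open>
  Let \<open>N = n choose 2\<close>. A colouring of the graphs on \<open>[n]\<close> with about \<open>N\<close> colours in which a
  typical graph sees almost every colour within Hamming distance one has, by averaging, a colour
  class of density about \<open>1 / N\<close> that is reached from almost every graph; no smaller class can
  have this property, since a ball has \<open>N + 1\<close> elements. So it suffices to find such a colouring that
  is invariant under isomorphism.

  For labelled graphs, cut \<open>N\<close> bits into \<open>m\<close> blocks of \<open>2 ^ s - 1\<close> bits, with \<open>m\<close> a power of a large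
  prime. The Hamming syndrome turns a block into a symbol of an alphabet of size \<open>2 ^ s\<close>, which one bit
  flip changes into any other symbol. Reading the \<open>i\<close>-th symbol as a pair \<open>(a, b)\<close> modulo \<open>m\<close> and
  modulo \<open>2 ^ s div m\<close>, the colour is \<open>(\<Sum>a, \<Sum>i * a, \<Sum>b)\<close>: to change it by \<open>(x, y, z)\<close> with \<open>x\<close> a unit
  modulo \<open>m\<close>, alter the block \<open>i = y / x\<close>. Such products \<open>m * 2 ^ s\<close> approximate every \<open>N\<close> because \<open>log 2 p\<close>
  is irrational.

  To remove the labels, label a vertex by its rank in an order that a single edge flip rarely
  affects. Sort the vertices into classes by degree modulo a large constant \<open>q\<close> and record for each
  vertex the number of its neighbours in each of nine of the classes. A flip matters only if an
  endpoint lies in or next to one of these classes, which is rare for large \<open>q\<close>. Two given vertices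
  \<open>u\<close>, \<open>v\<close> share these nine numbers with probability \<open>o(n powr -2)\<close>: once it is known which vertices
  are adjacent to exactly one of \<open>u\<close>, \<open>v\<close>, to which one is decided by independent fair coins that do
  not influence the degrees of these vertices.
\<close>

section \<open>Covering codes\<close>

text \<open>
  Bits of a block are indexed by the nonempty subsets of \<open>{..<s}\<close>, that is, by the nonzero vectors
  of the binary space of dimension \<open>s\<close>, and \<open>p\<close> says which bits are set.
\<close>

definition block_syndrome :: "nat \<Rightarrow> (nat set \<Rightarrow> bool) \<Rightarrow> nat set" where
  "block_syndrome s p = {b \<in> {..<s}. odd (card {j. j \<subseteq> {..<s} \<and> p j \<and> b \<in> j})}"

text \<open>Each set bit \<open>j\<close> contributes the vector \<open>j\<close> to a sum over the
  field with two elements, so toggling the bit \<open>j0\<close> adds the vector \<open>j0\<close>.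
  Any prescribed nonzero change of the syndrome is therefore the effect of exactly one flip.\<close>

lemma block_syndrome_flip:
  assumes "j0 \<subseteq> {..<s}"
  shows "block_syndrome s (p(j0 := \<not> p j0)) = sym_diff (block_syndrome s p) j0"
proof -
  have "odd (card {j. j \<subseteq> {..<s} \<and> (p(j0 := \<not> p j0)) j \<and> b \<in> j}) \<longleftrightarrow>
        (odd (card {j. j \<subseteq> {..<s} \<and> p j \<and> b \<in> j}) \<noteq> (b \<in> j0))" for b
  proof (cases "b \<in> j0")
    case False
    have "{j. j \<subseteq> {..<s} \<and> (p(j0 := \<not> p j0)) j \<and> b \<in> j} = {j. j \<subseteq> {..<s} \<and> p j \<and> b \<in> j}"
      using False by auto
    then show ?thesis using False by simp
  next
    case True
    define S where "S = {j. j \<subseteq> {..<s} \<and> p j \<and> b \<in> j} - {j0}"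
    have S: "finite S" "j0 \<notin> S"
      unfolding S_def by (auto intro: finite_subset[of _ "Pow {..<s}"])
    have "{j. j \<subseteq> {..<s} \<and> (p(j0 := \<not> p j0)) j \<and> b \<in> j} = (if p j0 then S else insert j0 S)"
      and "{j. j \<subseteq> {..<s} \<and> p j \<and> b \<in> j} = (if p j0 then insert j0 S else S)"
      using True assms by (auto simp: S_def)
    then show ?thesis using True S
      by (simp only: split: if_split) auto
  qed
  then show ?thesis
    using assms unfolding block_syndrome_def by blast
qed

text \<open>Translation by \<open>a\<close> carries the units modulo \<open>m\<close> to these
  residues. In the covering code they are the values of the first coordinate that differ from the
  current one by a unit.\<close>

lemma card_coprime_shift:
  fixes a :: int
  assumes "0 < m"
  shows "card {s \<in> {0..<int m}. coprime (s - a) (int m)} = totient m"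
proof -
  have "bij_betw (\<lambda>k. (int k + a) mod int m) (totatives m) {s \<in> {0..<int m}. coprime (s - a) (int m)}"
  proof (rule bij_betwI')
    fix x y assume xy: "x \<in> totatives m" "y \<in> totatives m"
    have "x = y" if "(int x + a) mod int m = (int y + a) mod int m"
    proof -
      have "[int x + a = int y + a] (mod int m)" using that by (simp add: cong_def)
      then have "[int x = int y] (mod int m)" by (simp add: cong_add_rcancel)
      then have c: "[x = y] (mod m)" by (simp add: cong_int_iff)
      have "0 < x" "x \<le> m" "0 < y" "y \<le> m"
        using xy by (auto simp: totatives_def)
      then show ?thesis using c
        by (metis cong_def le_neq_implies_less mod_less mod_self not_gr_zero)
    qed
    then show "((int x + a) mod int m = (int y + a) mod int m) = (x = y)" by auto
  next
    fix x assume x: "x \<in> totatives m"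
    have "[(int x + a) mod int m - a = int x + a - a] (mod int m)"
      by (intro cong_diff) auto
    moreover have "coprime (int x) (int m)" using x by (auto simp: totatives_def)
    ultimately have "coprime ((int x + a) mod int m - a) (int m)"
      using cong_imp_coprime[of "int x" "(int x + a) mod int m - a"] by (simp add: cong_sym)
    then show "(int x + a) mod int m \<in> {s \<in> {0..<int m}. coprime (s - a) (int m)}"
      using assms by simp
  next
    fix s assume s: "s \<in> {s \<in> {0..<int m}. coprime (s - a) (int m)}"
    \<comment> \<open>For \<open>m = 1\<close> the only residue is 0, whereas
      \<open>totatives 1\<close> is \<open>{1}\<close>; hence the separate case.\<close>
    define k where "k = (if m = 1 then 1 else nat ((s - a) mod int m))"
    have "k \<in> totatives m"
    proof (cases "m = 1")
      case False
      have cop: "coprime ((s - a) mod int m) (int m)" using s by simp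
      have "(s - a) mod int m \<noteq> 0"
      proof
        assume "(s - a) mod int m = 0"
        then show False using cop False by simp
      qed
      moreover have "0 \<le> (s - a) mod int m" "(s - a) mod int m < int m" using assms by auto
      ultimately have "0 < k" "k \<le> m" "int k = (s - a) mod int m"
        using False by (auto simp: k_def nat_le_iff)
      then show ?thesis using cop by (metis coprime_int_iff in_totatives_iff)
    qed (auto simp: k_def totatives_def)
    moreover have "(int k + a) mod int m = s"
    proof (cases "m = 1")
      case False
      then have "(int k + a) mod int m = ((s - a) mod int m + a) mod int m"
        using assms by (simp add: k_def)
      then show ?thesis using s by (simp add: mod_simps)
    qed (use s in \<open>auto\<close>)
    ultimately show "\<exists>x\<in>totatives m. s = (int x + a) mod int m" by auto
  qed
  then show ?thesis by (simp add: totient_def bij_betw_same_card)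
qed

text \<open>This is the colouring for labelled graphs, with \<open>E\<close> the set of vertex
  pairs. Among the \<open>m * m * t\<close> colours, a ball of radius one is shown to contain those
  whose first coordinate differs from that of the centre by a unit; this leaves the factor
  \<open>totient m\<close> in place of one \<open>m\<close>.\<close>

lemma covering_code_exists:
  fixes E :: "'a set"
  assumes fin: "finite E" and m: "0 < m" and mt: "m * t \<le> 2 ^ s" and t: "0 < t"
    and E: "m * (2 ^ s - 1) \<le> card E"
  obtains c :: "'a set \<Rightarrow> int \<times> int \<times> int" where
    "\<And>x. c x \<in> {0..<int m} \<times> {0..<int m} \<times> {0..<int t}"
    "\<And>x. x \<subseteq> E \<Longrightarrow> m * t * totient m \<le> card (c ` {y. y \<subseteq> E \<and> card (sym_diff x y) \<le> 1})"
proof -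
  let ?P = "Pow {..<s} :: nat set set"
  have "card ({..<m} \<times> (?P - {{}})) \<le> card E"
    using E by (simp add: card_Diff_singleton card_Pow card_cartesian_product)
  then obtain idx where idx: "idx ` ({..<m} \<times> (?P - {{}})) \<subseteq> E" "inj_on idx ({..<m} \<times> (?P - {{}}))"
    using card_le_inj[of "{..<m} \<times> (?P - {{}})" E] fin by auto
  have "card ({0..<int m} \<times> {0..<int t}) \<le> card ?P"
    using mt by (simp add: card_Pow card_cartesian_product)
  then obtain h where h: "h ` ({0..<int m} \<times> {0..<int t}) \<subseteq> ?P" "inj_on h ({0..<int m} \<times> {0..<int t})"
    using card_le_inj[of "{0..<int m} \<times> {0..<int t}" ?P] by auto
  \<comment> \<open>\<open>g\<close> decodes a syndrome into a symbol. Outside the image of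
    \<open>h\<close> its value is unspecified, which is harmless: old values only enter sums reduced
    modulo \<open>m\<close> or \<open>t\<close>, and new symbols are always written through
    \<open>h\<close>.\<close>
  define g where "g = the_inv_into ({0..<int m} \<times> {0..<int t}) h"
  have g: "g (h z) = z" if "z \<in> {0..<int m} \<times> {0..<int t}" for z
    using that h(2) by (simp add: g_def the_inv_into_f_f)
  define sym where "sym x i = block_syndrome s (\<lambda>j. idx (i, j) \<in> x)" for x i
  have sym: "sym x i \<in> ?P" for x i by (auto simp: sym_def block_syndrome_def)
  have change: "\<exists>y \<subseteq> E. card (sym_diff x y) \<le> 1 \<and> sym y i = z \<and> (\<forall>k<m. k \<noteq> i \<longrightarrow> sym y k = sym x k)"
    if "x \<subseteq> E" "i < m" "z \<in> ?P" for x i z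
  proof (cases "z = sym x i")
    case True
    then show ?thesis using that by (intro exI[of _ x]) auto
  next
    case False
    \<comment> \<open>The bit to flip is indexed by the difference of the present and the desired
      syndrome.\<close>
    define j where "j = sym_diff (sym x i) z"
    have j: "j \<in> ?P - {{}}" using sym[of x i] that False by (auto simp: j_def)
    define y where "y = sym_diff x {idx (i, j)}"
    have idxE: "idx (i, j) \<in> E" using idx(1) that(2) j by auto
    have diff: "sym_diff x y = {idx (i, j)}" by (auto simp: y_def)
    have y: "y \<subseteq> E" using that(1) idxE by (auto simp: y_def)
    have mem: "idx (k, l) \<in> y \<longleftrightarrow> (idx (k, l) \<in> x) \<noteq> (k = i \<and> l = j)"
      if "k < m" "l \<in> ?P - {{}}" for k l
    proof -
      have "idx (k, l) = idx (i, j) \<longleftrightarrow> k = i \<and> l = j"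
        using inj_onD[OF idx(2), of "(k, l)" "(i, j)"] that j \<open>i < m\<close> by auto
      then show ?thesis by (auto simp: y_def)
    qed
    have syn_cong: "block_syndrome s p = block_syndrome s p'" if "\<And>l. l \<in> ?P - {{}} \<Longrightarrow> p l = p' l" for p p'
    proof -
      have "{j. j \<subseteq> {..<s} \<and> p j \<and> b \<in> j} = {j. j \<subseteq> {..<s} \<and> p' j \<and> b \<in> j}" for b
        using that by auto
      then show ?thesis unfolding block_syndrome_def by simp
    qed
    have "sym y k = sym x k" if "k < m" "k \<noteq> i" for k
      unfolding sym_def by (rule syn_cong) (use mem that in auto)
    moreover have "sym y i = z"
    proof -
      have "sym y i = block_syndrome s ((\<lambda>l. idx (i, l) \<in> x)(j := \<not> idx (i, j) \<in> x))"
        unfolding sym_def by (rule syn_cong) (use mem \<open>i < m\<close> in auto)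
      also have "\<dots> = sym_diff (sym x i) j"
        unfolding sym_def using j by (subst block_syndrome_flip) auto
      also have "\<dots> = z" by (auto simp: j_def)
      finally show ?thesis .
    qed
    ultimately show ?thesis using y diff by (intro exI[of _ y]) auto
  qed
  define c where "c x = ((\<Sum>i<m. fst (g (sym x i))) mod int m,
     (\<Sum>i<m. int i * fst (g (sym x i))) mod int m, (\<Sum>i<m. snd (g (sym x i))) mod int t)" for x
  have range: "c x \<in> {0..<int m} \<times> {0..<int m} \<times> {0..<int t}" for x
    using m t by (auto simp: c_def)
  have many: "m * t * totient m \<le> card (c ` {y. y \<subseteq> E \<and> card (sym_diff x y) \<le> 1})" if x: "x \<subseteq> E" for x
  proof -
    let ?B = "{y. y \<subseteq> E \<and> card (sym_diff x y) \<le> 1}"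
    let ?a = "\<lambda>i. fst (g (sym x i))" and ?b = "\<lambda>i. snd (g (sym x i))"
    define S1 where "S1 = (\<Sum>i<m. ?a i)"
    define S2 where "S2 = (\<Sum>i<m. int i * ?a i)"
    define S3 where "S3 = (\<Sum>i<m. ?b i)"
    let ?R = "{r \<in> {0..<int m}. coprime (r - S1) (int m)} \<times> {0..<int m} \<times> {0..<int t}"
    have "?R \<subseteq> c ` ?B"
    proof
      fix w assume w: "w \<in> ?R"
      obtain r1 r2 r3 where w': "w = (r1, r2, r3)" by (cases w)
      have r: "0 \<le> r1" "r1 < int m" "coprime (r1 - S1) (int m)" "0 \<le> r2" "r2 < int m" "0 \<le> r3" "r3 < int t"
        using w by (auto simp: w')
      obtain e where e: "[(r1 - S1) * e = 1] (mod int m)"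
        using cong_solve_coprime_int[OF r(3)] by blast
      \<comment> \<open>Raising the first part of symbol \<open>i\<close> by \<open>r1 - S1\<close>
        raises the weighted sum by \<open>i * (r1 - S1)\<close>. Since \<open>e\<close> inverts
        \<open>r1 - S1\<close>, this choice of \<open>i\<close> makes that increment
        \<open>r2 - S2\<close> modulo \<open>m\<close>.\<close>
      define i where "i = nat ((e * (r2 - S2)) mod int m)"
      have i: "i < m" using m by (simp add: i_def nat_less_iff)
      have inti: "[int i = e * (r2 - S2)] (mod int m)"
        using m by (simp add: i_def cong_def)
      define a' where "a' = (?a i + (r1 - S1)) mod int m"
      define b' where "b' = (?b i + (r3 - S3)) mod int t"
      have ab: "(a', b') \<in> {0..<int m} \<times> {0..<int t}" using m t by (auto simp: a'_def b'_def)
      have hab: "h (a', b') \<in> ?P" using h(1) ab by blast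
      obtain y where y: "y \<subseteq> E" "card (sym_diff x y) \<le> 1" "sym y i = h (a', b')"
        "\<forall>k<m. k \<noteq> i \<longrightarrow> sym y k = sym x k"
        using change[OF x i hab] by blast
      have gy: "g (sym y i) = (a', b')" using g[OF ab] y(3) by simp
      \<comment> \<open>Stated for a general summand \<open>f\<close> so that it serves all three
        coordinates of the colour.\<close>
      have split: "(\<Sum>k<m. f k (g (sym y k))) = (\<Sum>k<m. f k (g (sym x k))) - f i (g (sym x i)) + f i (a', b')"
        for f :: "nat \<Rightarrow> int \<times> int \<Rightarrow> int"
      proof -
        have "(\<Sum>k<m. f k (g (sym y k))) = f i (a', b') + (\<Sum>k\<in>{..<m} - {i}. f k (g (sym y k)))"
          using i gy by (subst sum.remove[of _ i]) auto
        also have "(\<Sum>k\<in>{..<m} - {i}. f k (g (sym y k))) = (\<Sum>k\<in>{..<m} - {i}. f k (g (sym x k)))"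
          using y(4) by (intro sum.cong) auto
        also have "\<dots> = (\<Sum>k<m. f k (g (sym x k))) - f i (g (sym x i))"
          using i by (subst (2) sum.remove[of _ i]) auto
        finally show ?thesis by simp
      qed
      have a'c: "[a' = ?a i + (r1 - S1)] (mod int m)" by (simp add: a'_def)
      have b'c: "[b' = ?b i + (r3 - S3)] (mod int t)" by (simp add: b'_def)
      have "[S1 - ?a i + a' = S1 - ?a i + (?a i + (r1 - S1))] (mod int m)"
        by (intro cong_add a'c) auto
      then have c1: "(S1 - ?a i + a') mod int m = r1" using r by (simp add: cong_def)
      have "[S3 - ?b i + b' = S3 - ?b i + (?b i + (r3 - S3))] (mod int t)"
        by (intro cong_add b'c) auto
      then have c3: "(S3 - ?b i + b') mod int t = r3" using r by (simp add: cong_def)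
      have "[S2 - int i * ?a i + int i * a' = S2 - int i * ?a i + int i * (?a i + (r1 - S1))] (mod int m)"
        by (intro cong_add cong_mult a'c) auto
      also have "S2 - int i * ?a i + int i * (?a i + (r1 - S1)) = S2 + int i * (r1 - S1)"
        by (simp add: algebra_simps)
      also have "[S2 + int i * (r1 - S1) = S2 + e * (r2 - S2) * (r1 - S1)] (mod int m)"
        by (intro cong_add cong_mult inti) auto
      also have "S2 + e * (r2 - S2) * (r1 - S1) = S2 + (r1 - S1) * e * (r2 - S2)"
        by (simp add: algebra_simps)
      also have "[S2 + (r1 - S1) * e * (r2 - S2) = S2 + 1 * (r2 - S2)] (mod int m)"
        by (intro cong_add cong_mult e) auto
      finally have c2: "(S2 - int i * ?a i + int i * a') mod int m = r2" using r by (simp add: cong_def)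
      have "c y = w"
        using c1 c2 c3 split[of "\<lambda>_. fst"] split[of "\<lambda>_. snd"] split[of "\<lambda>k z. int k * fst z"]
        by (simp add: c_def w' S1_def S2_def S3_def)
      then show "w \<in> c ` ?B" using y by blast
    qed
    moreover have "finite (c ` ?B)"
      by (rule finite_subset[OF image_subsetI[OF range]]) auto
    ultimately have "card ?R \<le> card (c ` ?B)" by (rule card_mono[rotated])
    moreover have "card ?R = totient m * (m * t)"
      using card_coprime_shift[OF m, of S1] by (simp add: card_cartesian_product)
    ultimately show ?thesis by (simp add: mult.commute)
  qed
  show thesis using that[of c] range many by blast
qed

section \<open>Canonical labels\<close>

definition vdeg :: "nat \<Rightarrow> graph \<Rightarrow> nat \<Rightarrow> nat" where
  "vdeg n G v = card {x \<in> {1..n}. {v, x} \<in> G}"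

text \<open>The shift \<open>c\<close> is a free parameter. It is chosen for each \<open>n\<close>
  by averaging, so that on average few vertices fall into the classes 0 to 10.\<close>

definition vclass :: "nat \<Rightarrow> nat \<Rightarrow> nat \<Rightarrow> graph \<Rightarrow> nat \<Rightarrow> nat" where
  "vclass n q c G v = (vdeg n G v + c) mod q"

definition class_nbrs :: "nat \<Rightarrow> nat \<Rightarrow> nat \<Rightarrow> graph \<Rightarrow> nat \<Rightarrow> nat \<Rightarrow> nat" where
  "class_nbrs n q c G v j = card {x \<in> {1..n}. {v, x} \<in> G \<and> vclass n q c G x = j}"

text \<open>Encoding the list of nine counts injectively as a natural number provides a linear
  order. Which order results is immaterial, as it does not refer to the names of the
  vertices.\<close>

definition profile :: "nat \<Rightarrow> nat \<Rightarrow> nat \<Rightarrow> graph \<Rightarrow> nat \<Rightarrow> nat" where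
  "profile n q c G v = to_nat (map (class_nbrs n q c G v) [1..<10])"

definition label :: "nat \<Rightarrow> nat \<Rightarrow> nat \<Rightarrow> graph \<Rightarrow> nat \<Rightarrow> nat" where
  "label n q c G v = card {w \<in> {1..n}. profile n q c G w \<le> profile n q c G v}"

definition separated :: "nat \<Rightarrow> nat \<Rightarrow> nat \<Rightarrow> graph \<Rightarrow> bool" where
  "separated n q c G \<longleftrightarrow> inj_on (profile n q c G) {1..n}"

definition canonical_form :: "nat \<Rightarrow> nat \<Rightarrow> nat \<Rightarrow> graph \<Rightarrow> graph" where
  "canonical_form n q c G = (\<lambda>e. label n q c G ` e) ` G"

definition hamming_ball :: "nat \<Rightarrow> graph \<Rightarrow> graph set" where
  "hamming_ball n G = {H. H \<subseteq> pairs n \<and> card (sym_diff G H) \<le> 1}"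

lemma mem_pairs_iff: "e \<in> pairs n \<longleftrightarrow> (\<exists>u v. e = {u, v} \<and> u \<noteq> v \<and> u \<in> {1..n} \<and> v \<in> {1..n})"
proof
  assume "e \<in> pairs n"
  then obtain u v where "e = {u, v}" "u \<noteq> v" "e \<subseteq> {1..n}" by (auto simp: pairs_def card_2_iff)
  then show "\<exists>u v. e = {u, v} \<and> u \<noteq> v \<and> u \<in> {1..n} \<and> v \<in> {1..n}" by blast
qed (auto simp: pairs_def)

text \<open>A larger profile has a strictly larger set of profiles below it, because that set
  contains the vertex itself. For the same reason ranks start at 1, so they fill
  \<open>{1..n}\<close>.\<close>

lemma label_bij:
  assumes "separated n q c G"
  shows "bij_betw (label n q c G) {1..n} {1..n}"
proof -
  have inj: "inj_on (label n q c G) {1..n}"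
  proof (rule linorder_inj_onI')
    have *: "label n q c G u \<noteq> label n q c G v"
      if "u \<in> {1..n}" "v \<in> {1..n}" "profile n q c G u < profile n q c G v" for u v
    proof -
      have "{w \<in> {1..n}. profile n q c G w \<le> profile n q c G u} \<subset> {w \<in> {1..n}. profile n q c G w \<le> profile n q c G v}"
        using that by (intro psubsetI) (auto simp: set_eq_iff intro!: exI[of _ v] dest: order_trans[OF _ less_imp_le])
      then have "label n q c G u < label n q c G v"
        unfolding label_def by (intro psubset_card_mono) auto
      then show ?thesis by simp
    qed
    fix u v assume uv: "u \<in> {1..n}" "v \<in> {1..n}" "u < v"
    then have "profile n q c G u \<noteq> profile n q c G v"
      using assms unfolding separated_def by (metis inj_onD less_irrefl)
    then show "label n q c G u \<noteq> label n q c G v"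
      using *[of u v] *[of v u] uv by (metis linorder_neqE_nat)
  qed
  have "label n q c G ` {1..n} \<subseteq> {1..n}"
  proof
    fix l assume "l \<in> label n q c G ` {1..n}"
    then obtain v where v: "v \<in> {1..n}" "l = label n q c G v" by auto
    have "label n q c G v \<le> card {1..n}"
      unfolding label_def by (intro card_mono) auto
    moreover have "card {v} \<le> label n q c G v"
      unfolding label_def using v by (intro card_mono) auto
    ultimately show "l \<in> {1..n}" using v by simp
  qed
  then have "label n q c G ` {1..n} = {1..n}"
    using inj by (metis card_image card_subset_eq finite_atLeastAtMost)
  then show ?thesis using inj by (simp add: bij_betw_def)
qed

section \<open>Invariance of the canonical labels under isomorphism\<close>

context
  fixes n :: nat and G H :: graph and \<pi> :: "nat \<Rightarrow> nat"
  assumes \<pi>: "bij_betw \<pi> {1..n} {1..n}"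
    and adj: "\<And>u v. u \<in> {1..n} \<Longrightarrow> v \<in> {1..n} \<Longrightarrow> {u, v} \<in> G \<longleftrightarrow> {\<pi> u, \<pi> v} \<in> H"
begin

text \<open>Change of variables along \<open>\<pi>\<close>; degrees, class counts and ranks are all
  cardinalities of this shape.\<close>

lemma iso_card: "card {x \<in> {1..n}. P (\<pi> x)} = card {x \<in> {1..n}. P x}"
proof -
  have im: "\<pi> ` {1..n} = {1..n}" and inj: "inj_on \<pi> {1..n}"
    using \<pi> by (simp_all add: bij_betw_def)
  have "{x \<in> {1..n}. P x} = {x \<in> \<pi> ` {1..n}. P x}" by (simp only: im)
  also have "\<dots> = \<pi> ` {x \<in> {1..n}. P (\<pi> x)}" by auto
  finally have "{x \<in> {1..n}. P x} = \<pi> ` {x \<in> {1..n}. P (\<pi> x)}" .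
  moreover have "inj_on \<pi> {x \<in> {1..n}. P (\<pi> x)}"
    by (rule inj_on_subset[OF inj]) auto
  ultimately show ?thesis by (simp add: card_image)
qed

lemma vdeg_iso: "v \<in> {1..n} \<Longrightarrow> vdeg n H (\<pi> v) = vdeg n G v"
  unfolding vdeg_def iso_card[symmetric, of "\<lambda>x. {\<pi> v, x} \<in> H"]
  by (rule arg_cong[where f = card]) (use adj in blast)

lemma vclass_iso: "v \<in> {1..n} \<Longrightarrow> vclass n q c H (\<pi> v) = vclass n q c G v"
  by (simp add: vclass_def vdeg_iso)

lemma class_nbrs_iso: "v \<in> {1..n} \<Longrightarrow> class_nbrs n q c H (\<pi> v) j = class_nbrs n q c G v j"
  unfolding class_nbrs_def iso_card[symmetric, of "\<lambda>x. {\<pi> v, x} \<in> H \<and> vclass n q c H x = j"]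
  by (rule arg_cong[where f = card]) (use adj vclass_iso in \<open>simp cong: conj_cong\<close>)

lemma profile_iso: "v \<in> {1..n} \<Longrightarrow> profile n q c H (\<pi> v) = profile n q c G v"
proof -
  assume "v \<in> {1..n}"
  then have "class_nbrs n q c H (\<pi> v) = class_nbrs n q c G v"
    using class_nbrs_iso by blast
  then show ?thesis by (simp add: profile_def)
qed

lemma label_iso: "v \<in> {1..n} \<Longrightarrow> label n q c H (\<pi> v) = label n q c G v"
  unfolding label_def iso_card[symmetric, of "\<lambda>w. profile n q c H w \<le> profile n q c H (\<pi> v)"]
  by (rule arg_cong[where f = card]) (use profile_iso in auto)

lemma separated_iso: "separated n q c H \<longleftrightarrow> separated n q c G"
proof -
  have "separated n q c H \<longleftrightarrow> inj_on (profile n q c H) (\<pi> ` {1..n})"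
    using \<pi> by (simp add: separated_def bij_betw_def)
  also have "\<dots> \<longleftrightarrow> inj_on (profile n q c H \<circ> \<pi>) {1..n}"
    using \<pi> comp_inj_on_iff[of \<pi> "{1..n}" "profile n q c H"] by (simp add: bij_betw_def)
  also have "\<dots> \<longleftrightarrow> separated n q c G"
    unfolding separated_def by (rule inj_on_cong) (use profile_iso in auto)
  finally show ?thesis .
qed

text \<open>\<open>H\<close> is the image of \<open>G\<close> under \<open>\<pi>\<close>, and the
  label of \<open>\<pi> v\<close> in \<open>H\<close> is that of \<open>v\<close> in
  \<open>G\<close>, so \<open>\<pi>\<close> cancels when edges are replaced by their labels.\<close>

lemma canonical_form_iso:
  assumes "G \<in> graphs n" "H \<in> graphs n"
  shows "canonical_form n q c H = canonical_form n q c G"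
proof -
  have "H = (\<lambda>e. \<pi> ` e) ` G"
  proof (intro equalityI subsetI)
    fix e assume e: "e \<in> H"
    then obtain a b where ab: "e = {a, b}" "a \<in> {1..n}" "b \<in> {1..n}"
      using assms(2) unfolding graphs_def by (metis PowD mem_pairs_iff subsetD)
    then obtain u v where uv: "u \<in> {1..n}" "v \<in> {1..n}" "a = \<pi> u" "b = \<pi> v"
      using \<pi> unfolding bij_betw_def by blast
    then show "e \<in> (\<lambda>e. \<pi> ` e) ` G" using adj[of u v] e ab by (intro image_eqI[of _ _ "{u, v}"]) auto
  next
    fix e assume "e \<in> (\<lambda>e. \<pi> ` e) ` G"
    then obtain d where d: "d \<in> G" "e = \<pi> ` d" by auto
    then obtain u v where uv: "d = {u, v}" "u \<in> {1..n}" "v \<in> {1..n}"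
      using assms(1) unfolding graphs_def by (metis PowD mem_pairs_iff subsetD)
    then show "e \<in> H" using d adj[of u v] by simp
  qed
  moreover have "label n q c H ` \<pi> ` e = label n q c G ` e" if "e \<in> G" for e
  proof -
    have "e \<subseteq> {1..n}" using that assms(1) by (auto simp: graphs_def pairs_def)
    then show ?thesis unfolding image_image by (intro image_cong refl label_iso) blast
  qed
  ultimately show ?thesis
    unfolding canonical_form_def by (simp add: image_image cong: image_cong)
qed

end

lemma mod_add_one_cases:
  fixes a q :: nat
  assumes "k < a mod q"
  shows "Suc a mod q = 0 \<or> k < Suc a mod q"
  using assms by (auto simp: mod_Suc)

text \<open>
  A flip moves its endpoints to an adjacent class modulo \<open>q\<close>, so it does not affect the counted
  classes \<open>1, \<dots>, 9\<close> if both endpoints are outside the classes \<open>0, \<dots>, 10\<close>.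
\<close>

lemma class_nbrs_flip:
  assumes G: "G \<in> graphs n" and u: "u \<in> {1..n}" and v: "v \<in> {1..n}" and uv: "u \<noteq> v"
    and cu: "10 < vclass n q c G u" and cv: "10 < vclass n q c G v" and j: "j \<in> {1..<10}"
  shows "class_nbrs n q c (sym_diff G {{u, v}}) w j = class_nbrs n q c G w j"
proof -
  let ?G' = "sym_diff G {{u, v}}"
  have deg_other: "vdeg n ?G' x = vdeg n G x" if "x \<notin> {u, v}" for x
    unfolding vdeg_def using that by (intro arg_cong[where f = card]) (auto simp: doubleton_eq_iff)
  have deg_end: "vdeg n ?G' a = Suc (vdeg n G a) \<or> Suc (vdeg n ?G' a) = vdeg n G a"
    if ab: "{a, b} = {u, v}" "a \<noteq> b" "b \<in> {1..n}" for a b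
  proof -
    define S where "S = {x \<in> {1..n}. {a, x} \<in> G} - {b}"
    have eq: "{a, x} \<in> ?G' \<longleftrightarrow> ({a, x} \<in> G) \<noteq> (x = b)" for x
      using ab by (auto simp: doubleton_eq_iff)
    have 1: "{x \<in> {1..n}. {a, x} \<in> ?G'} = (if {a, b} \<in> G then S else insert b S)"
      unfolding eq S_def using ab(3) by auto
    have 2: "{x \<in> {1..n}. {a, x} \<in> G} = (if {a, b} \<in> G then insert b S else S)"
      unfolding S_def using ab(3) by auto
    have "card (insert b S) = Suc (card S)" by (rule card_insert_disjoint) (auto simp: S_def)
    then show ?thesis unfolding vdeg_def 1 2 by (simp split: if_split)
  qed
  have class_end: "vclass n q c ?G' a \<noteq> j \<and> vclass n q c G a \<noteq> j"
    if "{a, b} = {u, v}" "a \<noteq> b" "b \<in> {1..n}" "10 < vclass n q c G a" for a b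
  proof -
    \<comment> \<open>From a class above 10, one step up wraps around to 0 at worst and one step
      down ends at 10 at worst. Thus 0 and 10 act as buffers around the counted classes.\<close>
    have "vclass n q c ?G' a = 0 \<or> 9 < vclass n q c ?G' a"
      using deg_end[OF that(1-3)]
    proof
      assume "vdeg n ?G' a = Suc (vdeg n G a)"
      then show ?thesis
        using that(4) mod_add_one_cases[of 10 "vdeg n G a + c" q] by (auto simp: vclass_def)
    next
      assume "Suc (vdeg n ?G' a) = vdeg n G a"
      then have "10 < Suc (vdeg n ?G' a + c) mod q"
        using that(4) unfolding vclass_def by (metis add_Suc)
      then show ?thesis by (auto simp: vclass_def mod_Suc split: if_splits)
    qed
    then show ?thesis using that(4) j by auto
  qed
  have u': "vclass n q c ?G' u \<noteq> j \<and> vclass n q c G u \<noteq> j" by (rule class_end[of u v]) (use assms in auto)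
  have v': "vclass n q c ?G' v \<noteq> j \<and> vclass n q c G v \<noteq> j" by (rule class_end[of v u]) (use assms in auto)
  have "({w, x} \<in> ?G' \<and> vclass n q c ?G' x = j) = ({w, x} \<in> G \<and> vclass n q c G x = j)" for x
  proof (cases "x \<in> {u, v}")
    case True
    then show ?thesis using u' v' by auto
  next
    case False
    then show ?thesis using deg_other[of x] by (auto simp: vclass_def doubleton_eq_iff)
  qed
  then show ?thesis unfolding class_nbrs_def by simp
qed

lemma profile_flip:
  assumes "G \<in> graphs n" "u \<in> {1..n}" "v \<in> {1..n}" "u \<noteq> v"
    and "10 < vclass n q c G u" "10 < vclass n q c G v"
  shows "profile n q c (sym_diff G {{u, v}}) = profile n q c G"
proof
  fix w
  have "map (class_nbrs n q c (sym_diff G {{u, v}}) w) [1..<10] = map (class_nbrs n q c G w) [1..<10]"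
    using class_nbrs_flip[OF assms] by (intro map_cong) auto
  then show "profile n q c (sym_diff G {{u, v}}) w = profile n q c G w"
    unfolding profile_def by simp
qed

section \<open>Transfer of the colouring to unlabelled graphs\<close>

text \<open>Graphs without distinct labels all receive the colour of the empty graph. This default
  keeps the colouring invariant under isomorphism, and such graphs turn out to be rare.\<close>

definition canonical_colour ::
  "nat \<Rightarrow> nat \<Rightarrow> nat \<Rightarrow> (graph \<Rightarrow> 'a) \<Rightarrow> graph \<Rightarrow> 'a" where
  "canonical_colour n q c col G = col (if separated n q c G then canonical_form n q c G else {})"

lemma canonical_colour_iso:
  assumes "isomorphic n G H" "G \<in> graphs n" "H \<in> graphs n"
  shows "canonical_colour n q c col G = canonical_colour n q c col H"
proof -
  obtain \<pi> where \<pi>: "bij_betw \<pi> {1..n} {1..n}"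
    "\<And>u v. u \<in> {1..n} \<Longrightarrow> v \<in> {1..n} \<Longrightarrow> {u, v} \<in> G \<longleftrightarrow> {\<pi> u, \<pi> v} \<in> H"
    using assms(1) unfolding isomorphic_def by blast
  show ?thesis
    using separated_iso[OF \<pi>] canonical_form_iso[OF \<pi>] assms by (simp add: canonical_colour_def)
qed

lemma pairs_image:
  assumes "bij_betw f {1..n} {1..n}"
  shows "bij_betw (\<lambda>e. f ` e) (pairs n) (pairs n)"
proof -
  have inj: "inj_on (\<lambda>e. f ` e) (pairs n)"
    using assms by (auto simp: inj_on_def pairs_def bij_betw_def inj_on_image_eq_iff)
  have "(\<lambda>e. f ` e) ` pairs n \<subseteq> pairs n"
  proof (safe)
    fix e assume e: "e \<in> pairs n"
    then have "e \<subseteq> {1..n}" "card e = 2" by (auto simp: pairs_def)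
    moreover from this have "card (f ` e) = 2"
      using assms by (metis bij_betw_def card_image inj_on_subset)
    ultimately show "f ` e \<in> pairs n" using assms by (auto simp: pairs_def bij_betw_def)
  qed
  then have "(\<lambda>e. f ` e) ` pairs n = pairs n"
    using inj by (metis card_image card_subset_eq finite_pairs)
  then show ?thesis using inj by (simp add: bij_betw_def)
qed

lemma card_pairs_meeting:
  assumes "X \<subseteq> {1..n}"
  shows "card {e \<in> pairs n. e \<inter> X \<noteq> {}} \<le> n * card X"
proof -
  have "finite X" using assms finite_subset by blast
  have "{e \<in> pairs n. e \<inter> X \<noteq> {}} \<subseteq> (\<lambda>(u, v). {u, v}) ` (X \<times> {1..n})"
  proof
    fix e assume e: "e \<in> {e \<in> pairs n. e \<inter> X \<noteq> {}}"
    then obtain u v where "e = {u, v}" "u \<in> {1..n}" "v \<in> {1..n}" by (auto simp: mem_pairs_iff)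
    then consider "u \<in> X" "e = {u, v}" "v \<in> {1..n}" | "v \<in> X" "e = {v, u}" "u \<in> {1..n}" using e by auto
    then show "e \<in> (\<lambda>(u, v). {u, v}) ` (X \<times> {1..n})"
      by cases (auto intro!: rev_image_eqI)
  qed
  then have "card {e \<in> pairs n. e \<inter> X \<noteq> {}} \<le> card ((\<lambda>(u, v). {u, v}) ` (X \<times> {1..n}))"
    using \<open>finite X\<close> by (intro card_mono) auto
  also have "\<dots> \<le> card (X \<times> {1..n})" using \<open>finite X\<close> by (intro card_image_le) auto
  finally show ?thesis by (simp add: mult.commute card_cartesian_product)
qed

lemma finite_hamming_ball: "finite (hamming_ball n G)"
  by (rule finite_subset[of _ "Pow (pairs n)"]) (auto simp: hamming_ball_def finite_pairs)

lemma image_sym_diff_singleton: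
  assumes "\<And>d. d \<in> A \<Longrightarrow> f d = f e \<longleftrightarrow> d = e"
  shows "f ` sym_diff A {e} = sym_diff (f ` A) {f e}"
proof (cases "e \<in> A")
  case True
  then have "sym_diff A {e} = A - {e}" "sym_diff (f ` A) {f e} = f ` A - {f e}" by auto
  then show ?thesis using assms by auto
next
  case False
  then have "f e \<notin> f ` A" using assms by (metis imageE)
  then have "sym_diff A {e} = insert e A" "sym_diff (f ` A) {f e} = insert (f e) (f ` A)" using False by auto
  then show ?thesis by simp
qed

text \<open>A flip in the canonical form is the image of a flip of a pair \<open>e\<close> in
  \<open>G\<close>. If \<open>e\<close> avoids the classes 0 to 10, all labels survive, so flipping
  commutes with taking the canonical form and the colour is seen from \<open>G\<close> as well. Each
  remaining pair loses at most one colour.\<close>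

lemma canonical_colour_seen:
  assumes G: "G \<in> graphs n" and sep: "separated n q c G"
  shows "card (col ` hamming_ball n (canonical_form n q c G)) \<le>
    card (canonical_colour n q c col ` hamming_ball n G) + n * card {v \<in> {1..n}. vclass n q c G v \<le> 10}"
proof -
  let ?X = "{v \<in> {1..n}. vclass n q c G v \<le> 10}"
  let ?l = "label n q c G" and ?K = "canonical_form n q c G"
  let ?Bad = "{e \<in> pairs n. e \<inter> ?X \<noteq> {}}"
  let ?F = "canonical_colour n q c col"
  have bij: "bij_betw (\<lambda>e. ?l ` e) (pairs n) (pairs n)"
    by (rule pairs_image) (rule label_bij[OF sep])
  have GP: "G \<subseteq> pairs n" using G by (simp add: graphs_def)
  have KP: "?K \<subseteq> pairs n" using bij GP by (auto simp: canonical_form_def bij_betw_def)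
  have "col ` hamming_ball n ?K \<subseteq> ?F ` hamming_ball n G \<union> (\<lambda>e. col (sym_diff ?K {?l ` e})) ` ?Bad"
  proof
    fix z assume "z \<in> col ` hamming_ball n ?K"
    then obtain y where y: "y \<subseteq> pairs n" "card (sym_diff ?K y) \<le> 1" "z = col y"
      by (auto simp: hamming_ball_def)
    have fin: "finite (sym_diff ?K y)"
      using KP y(1) finite_pairs by (meson finite_Diff finite_UnI finite_subset)
    show "z \<in> ?F ` hamming_ball n G \<union> (\<lambda>e. col (sym_diff ?K {?l ` e})) ` ?Bad"
    proof (cases "sym_diff ?K y = {}")
      case True
      then have "y = ?K" by auto
      then have "z = ?F G" using y sep by (simp add: canonical_colour_def)
      moreover have "G \<in> hamming_ball n G" using GP by (simp add: hamming_ball_def)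
      ultimately show ?thesis by blast
    next
      case False
      then have "card (sym_diff ?K y) = 1" using y(2) fin
        by (metis card_0_eq less_one linorder_le_less_linear order_antisym)
      then obtain e' where e': "sym_diff ?K y = {e'}" by (metis card_1_singletonE)
      then have "e' \<in> pairs n" using KP y(1) by blast
      then obtain e where e: "e \<in> pairs n" "e' = ?l ` e"
        using bij unfolding bij_betw_def by blast
      have yK: "y = sym_diff ?K {?l ` e}" using e' e(2) by auto
      show ?thesis
      proof (cases "e \<in> ?Bad")
        case True
        then show ?thesis using y(3) yK by blast
      next
        case False
        obtain u v where uv: "e = {u, v}" "u \<noteq> v" "u \<in> {1..n}" "v \<in> {1..n}"
          using e(1) by (auto simp: mem_pairs_iff)
        have prof: "profile n q c (sym_diff G {e}) = profile n q c G"
          unfolding uv(1) using False e(1) uv by (intro profile_flip[OF G]) auto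
        have lab: "label n q c (sym_diff G {e}) = ?l" by (simp add: label_def prof fun_eq_iff)
        have sep': "separated n q c (sym_diff G {e})" using sep by (simp add: separated_def prof)
        have inj: "?l ` d = ?l ` e \<longleftrightarrow> d = e" if "d \<in> G" for d
          using bij that GP e(1) by (auto simp: bij_betw_def inj_on_def)
        have "canonical_form n q c (sym_diff G {e}) = sym_diff ?K {?l ` e}"
          unfolding canonical_form_def lab by (rule image_sym_diff_singleton) (use inj in blast)
        then have "z = ?F (sym_diff G {e})"
          using y(3) yK sep' by (simp add: canonical_colour_def)
        moreover have "sym_diff G (sym_diff G {e}) = {e}" by auto
        then have "sym_diff G {e} \<in> hamming_ball n G"
          using GP e(1) by (auto simp: hamming_ball_def)
        ultimately show ?thesis by blast
      qed
    qed
  qed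
  then have "card (col ` hamming_ball n ?K) \<le>
      card (?F ` hamming_ball n G \<union> (\<lambda>e. col (sym_diff ?K {?l ` e})) ` ?Bad)"
    by (intro card_mono) (auto simp: finite_hamming_ball finite_pairs)
  also have "\<dots> \<le> card (?F ` hamming_ball n G) + card ((\<lambda>e. col (sym_diff ?K {?l ` e})) ` ?Bad)"
    by (rule card_Un_le)
  also have "card ((\<lambda>e. col (sym_diff ?K {?l ` e})) ` ?Bad) \<le> card ?Bad"
    by (rule card_image_le) (simp add: finite_pairs)
  also have "card ?Bad \<le> n * card ?X" by (rule card_pairs_meeting) auto
  finally show ?thesis by simp
qed

section \<open>Averaging over the shift of the classes\<close>

lemma card_shift_mod:
  fixes d q k :: nat
  assumes "0 < q"
  shows "card {c \<in> {..<q}. (d + c) mod q \<le> k} \<le> Suc k"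
proof -
  have "inj_on (\<lambda>c. (d + c) mod q) {..<q}"
  proof (rule inj_onI)
    fix x y assume xy: "x \<in> {..<q}" "y \<in> {..<q}" "(d + x) mod q = (d + y) mod q"
    then have "[d + x = d + y] (mod q)" by (simp only: cong_def)
    then have "[x = y] (mod q)" by (simp only: cong_add_lcancel_nat)
    then show "x = y" using xy by (simp add: cong_def)
  qed
  then have "card {c \<in> {..<q}. (d + c) mod q \<le> k} = card ((\<lambda>c. (d + c) mod q) ` {c \<in> {..<q}. (d + c) mod q \<le> k})"
    by (subst card_image) (auto intro: inj_on_subset)
  also have "\<dots> \<le> card {..k}" by (intro card_mono) auto
  finally show ?thesis by simp
qed

text \<open>For each graph and vertex at most 11 of the \<open>q\<close> shifts put the vertex into
  the classes 0 to 10. Summing over all shifts, some shift is no worse than average, whatever the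
  degrees are.\<close>

lemma exists_good_shift:
  assumes "0 < q"
  shows "\<exists>c<q. q * (\<Sum>G\<in>graphs n. card {v \<in> {1..n}. vclass n q c G v \<le> 10}) \<le> 11 * n * card (graphs n)"
proof (rule ccontr)
  let ?f = "\<lambda>c. \<Sum>G\<in>graphs n. card {v \<in> {1..n}. vclass n q c G v \<le> 10}"
  assume "\<not> ?thesis"
  then have *: "11 * n * card (graphs n) < q * ?f c" if "c < q" for c using that by (meson not_le)
  have "q * (11 * n * card (graphs n)) = (\<Sum>c<q. 11 * n * card (graphs n))" by simp
  also have "\<dots> < (\<Sum>c<q. q * ?f c)"
    using assms * by (intro sum_strict_mono) auto
  also have "\<dots> = q * (\<Sum>c<q. ?f c)" by (simp add: sum_distrib_left)
  also have "(\<Sum>c<q. ?f c) = (\<Sum>c<q. \<Sum>G\<in>graphs n. \<Sum>v\<in>{1..n}. if vclass n q c G v \<le> 10 then 1 else 0)"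
    by (simp add: sum.If_cases Int_def)
  also have "\<dots> = (\<Sum>G\<in>graphs n. \<Sum>v\<in>{1..n}. \<Sum>c<q. if vclass n q c G v \<le> 10 then 1 else 0)"
    by (subst sum.swap) (intro sum.cong refl sum.swap)
  also have "\<dots> = (\<Sum>G\<in>graphs n. \<Sum>v\<in>{1..n}. card {c \<in> {..<q}. vclass n q c G v \<le> 10})"
    by (simp add: sum.If_cases Int_def)
  also have "\<dots> \<le> (\<Sum>G\<in>graphs n. \<Sum>v\<in>{1..n}. 11)"
    unfolding vclass_def using card_shift_mod[OF assms, where k = 10] by (intro sum_mono) auto
  also have "\<dots> = 11 * n * card (graphs n)" by simp
  finally show False by simp
qed

section \<open>Coincidences of vertex profiles\<close>

text \<open>The square of the usual bound, so that induction runs in the natural numbers. The ratio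
  of consecutive central coefficients is \<open>2 * (2 * k + 1) / (k + 1)\<close>, and the step
  reduces to \<open>(2 * k + 3) * (2 * k + 1) \<le> (2 * k + 2)\<^sup>2\<close>.\<close>

lemma central_binomial_upper: "(2 * k + 1) * ((2 * k) choose k)\<^sup>2 \<le> 16 ^ k"
proof (induction k)
  case (Suc k)
  let ?c = "(2 * k) choose k" and ?d = "(2 * Suc k) choose (Suc k)"
  have 1: "Suc k * ?d = (2 * k + 2) * (Suc (2 * k) choose k)"
    using Suc_times_binomial[of k "Suc (2 * k)"] by simp
  have "(Suc (2 * k) - k) * (Suc (2 * k) choose k) = Suc (2 * k) * ?c"
    using binomial_absorb_comp[of "Suc (2 * k)" k] by simp
  then have 2: "Suc k * (Suc (2 * k) choose k) = Suc (2 * k) * ?c" by (simp add: Suc_diff_le)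
  have "Suc k * ?d = 2 * (Suc k * (Suc (2 * k) choose k))"
    unfolding 1 by (simp add: algebra_simps del: binomial_Suc_Suc)
  then have "Suc k * ?d = 2 * (2 * k + 1) * ?c" unfolding 2 by simp
  then have "(Suc k * ?d)\<^sup>2 = (2 * (2 * k + 1) * ?c)\<^sup>2" by (rule arg_cong)
  then have sq: "(Suc k)\<^sup>2 * ?d\<^sup>2 = 2\<^sup>2 * (2 * k + 1)\<^sup>2 * ?c\<^sup>2" by (simp only: power_mult_distrib)
  have "(Suc k)\<^sup>2 * ((2 * Suc k + 1) * ?d\<^sup>2) = (2 * k + 3) * ((Suc k)\<^sup>2 * ?d\<^sup>2)"
    by (simp add: algebra_simps del: binomial_Suc_Suc)
  also have "\<dots> = 4 * ((2 * k + 3) * (2 * k + 1)) * ((2 * k + 1) * ?c\<^sup>2)"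
    unfolding sq by (simp add: power2_eq_square algebra_simps)
  also have "\<dots> \<le> 4 * (4 * (Suc k)\<^sup>2) * 16 ^ k"
    by (rule mult_le_mono[OF mult_le_mono2 Suc.IH]) (simp add: power2_eq_square algebra_simps)
  also have "\<dots> = (Suc k)\<^sup>2 * 16 ^ Suc k" by simp
  finally show ?case by simp
qed simp

lemma central_binomial_sqrt: "real ((2 * k) choose k) \<le> 4 ^ k / sqrt (2 * k + 1)"
proof -
  have "real ((2 * k + 1) * ((2 * k) choose k)\<^sup>2) \<le> real (16 ^ k)"
    using central_binomial_upper[of k] by (rule of_nat_mono)
  moreover have "((4::real) ^ k)\<^sup>2 = 16 ^ k"
    by (simp add: power2_eq_square flip: power_mult_distrib)
  ultimately have "(real ((2 * k) choose k) * sqrt (2 * k + 1))\<^sup>2 \<le> (4 ^ k)\<^sup>2"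
    by (simp add: power_mult_distrib algebra_simps)
  then have "real ((2 * k) choose k) * sqrt (2 * k + 1) \<le> 4 ^ k"
    by (rule power2_le_imp_le) simp
  then show ?thesis by (simp add: field_simps)
qed

text \<open>For even size only the middle layer qualifies. For odd size the two middle layers add
  up, by Pascal's rule, to the next central binomial coefficient, which accounts for the factor
  2.\<close>

lemma card_balanced_subsets:
  assumes "finite D"
  shows "real (card {Z. Z \<subseteq> D \<and> \<bar>2 * int (card Z) - int (card D)\<bar> \<le> 1})
    \<le> 2 / sqrt (real (card D) + 1) * 2 ^ card D"
proof (cases "even (card D)")
  case True
  then obtain k where k: "card D = 2 * k" by (elim evenE)
  have "{Z. Z \<subseteq> D \<and> \<bar>2 * int (card Z) - int (card D)\<bar> \<le> 1} = {Z. Z \<subseteq> D \<and> card Z = k}"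
    unfolding k by auto
  then have "real (card {Z. Z \<subseteq> D \<and> \<bar>2 * int (card Z) - int (card D)\<bar> \<le> 1}) = real ((2 * k) choose k)"
    using n_subsets[OF assms, of k] k by simp
  also have "\<dots> \<le> 4 ^ k / sqrt (2 * k + 1)" by (rule central_binomial_sqrt)
  also have "\<dots> \<le> 2 * (4 ^ k / sqrt (2 * k + 1))"
    using divide_nonneg_nonneg[of "4 ^ k" "sqrt (2 * k + 1)"] by (simp del: times_divide_eq_right)
  finally show ?thesis by (simp add: k power_mult add.commute)
next
  case False
  then obtain k where k: "card D = Suc (2 * k)" by (elim oddE) simp
  have "{Z. Z \<subseteq> D \<and> \<bar>2 * int (card Z) - int (card D)\<bar> \<le> 1} \<subseteq>
      {Z. Z \<subseteq> D \<and> card Z = k} \<union> {Z. Z \<subseteq> D \<and> card Z = Suc k}"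
    unfolding k by auto
  then have "card {Z. Z \<subseteq> D \<and> \<bar>2 * int (card Z) - int (card D)\<bar> \<le> 1} \<le>
      card ({Z. Z \<subseteq> D \<and> card Z = k} \<union> {Z. Z \<subseteq> D \<and> card Z = Suc k})"
    using assms by (intro card_mono) auto
  also have "\<dots> \<le> (card D choose k) + (card D choose Suc k)"
    unfolding n_subsets[OF assms, symmetric] by (rule card_Un_le)
  also have "\<dots> = (2 * Suc k) choose (Suc k)" by (simp add: k)
  finally have "real (card {Z. Z \<subseteq> D \<and> \<bar>2 * int (card Z) - int (card D)\<bar> \<le> 1}) \<le> real ((2 * Suc k) choose (Suc k))"
    by (rule of_nat_mono)
  also have "\<dots> \<le> 4 ^ Suc k / sqrt (2 * Suc k + 1)" by (rule central_binomial_sqrt)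
  also have "\<dots> \<le> 4 ^ Suc k / sqrt (2 * Suc k)"
    by (intro divide_left_mono mult_pos_pos) auto
  also have "\<dots> = 2 / sqrt (real (card D) + 1) * 2 ^ card D" by (simp add: k power_mult)
  finally show ?thesis .
qed

text \<open>Independence of disjoint blocks in counting form: \<open>Y\<close> is determined by its
  part in \<open>D i\<close> and the rest. The ground set \<open>W\<close> varies in the induction
  since it loses a block at each step.\<close>

lemma card_subsets_blockwise:
  fixes D :: "'i \<Rightarrow> 'a set" and h :: real
  assumes "finite I" "finite W" "0 \<le> h" "disjoint_family_on D I" "\<And>i. i \<in> I \<Longrightarrow> D i \<subseteq> W"
    and "\<And>i. i \<in> I \<Longrightarrow> real (card {Z. Z \<subseteq> D i \<and> P i Z}) \<le> h * 2 ^ card (D i)"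
  shows "real (card {Y. Y \<subseteq> W \<and> (\<forall>i\<in>I. P i (Y \<inter> D i))}) \<le> h ^ card I * 2 ^ card W"
  using assms
proof (induction I arbitrary: W rule: finite_induct)
  case empty
  then show ?case by (simp add: card_Pow flip: Pow_def)
next
  case (insert i I)
  have DW: "D i \<subseteq> W" using insert.prems by auto
  have fin: "finite (D i)" using DW insert.prems(1) finite_subset by blast
  let ?A = "{Z. Z \<subseteq> D i \<and> P i Z}" and ?B = "{Y. Y \<subseteq> W - D i \<and> (\<forall>k\<in>I. P k (Y \<inter> D k))}"
  have disj: "D k \<inter> D i = {}" if "k \<in> I" for k
    using insert.prems(3) insert.hyps(2) that by (auto simp: disjoint_family_on_def)
  have img: "(\<lambda>Y. (Y \<inter> D i, Y - D i)) ` {Y. Y \<subseteq> W \<and> (\<forall>k\<in>insert i I. P k (Y \<inter> D k))} \<subseteq> ?A \<times> ?B"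
  proof safe
    fix Y k assume Y: "Y \<subseteq> W" "\<forall>k\<in>insert i I. P k (Y \<inter> D k)" and k: "k \<in> I"
    have "(Y - D i) \<inter> D k = Y \<inter> D k" using disj[OF k] by auto
    then show "P k ((Y - D i) \<inter> D k)" using Y k by simp
  qed auto
  have inj: "inj_on (\<lambda>Y. (Y \<inter> D i, Y - D i)) {Y. Y \<subseteq> W \<and> (\<forall>k\<in>insert i I. P k (Y \<inter> D k))}"
  proof (rule inj_onI)
    fix X Y :: "'a set" assume "(X \<inter> D i, X - D i) = (Y \<inter> D i, Y - D i)"
    then have "X \<inter> D i = Y \<inter> D i" "X - D i = Y - D i" by (simp_all only: prod.inject)
    then show "X = Y" by blast
  qed
  have finAB: "finite (?A \<times> ?B)"
    using fin insert.prems(1) by (intro finite_cartesian_product) (auto intro: finite_subset[OF _ finite_Pow_iff[THEN iffD2]])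
  have "real (card {Y. Y \<subseteq> W \<and> (\<forall>k\<in>insert i I. P k (Y \<inter> D k))}) \<le> real (card (?A \<times> ?B))"
    by (rule of_nat_mono[OF card_inj_on_le[OF inj img finAB]])
  also have "\<dots> = real (card ?A) * real (card ?B)" by (simp add: card_cartesian_product)
  also have "\<dots> \<le> (h * 2 ^ card (D i)) * (h ^ card I * 2 ^ card (W - D i))"
  proof (intro mult_mono)
    show "real (card ?B) \<le> h ^ card I * 2 ^ card (W - D i)"
    proof (rule insert.IH)
      show "disjoint_family_on D I" using insert.prems(3) by (rule disjoint_family_on_mono[rotated]) auto
      show "D k \<subseteq> W - D i" if "k \<in> I" for k using insert.prems(4)[of k] disj[OF that] that by auto
    qed (use insert.prems in auto)
  qed (use insert.prems in auto)
  also have "\<dots> = h ^ card (insert i I) * 2 ^ (card (D i) + card (W - D i))"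
    using insert.hyps by (simp add: power_add)
  also have "card (D i) + card (W - D i) = card W"
    using DW insert.prems(1) fin by (simp add: card_Diff_subset card_mono)
  finally show ?case .
qed

definition profile_clash :: "nat \<Rightarrow> nat \<Rightarrow> nat \<Rightarrow> graph \<Rightarrow> nat \<Rightarrow> nat \<Rightarrow> bool" where
  "profile_clash n q c G u v \<longleftrightarrow> (\<forall>j\<in>{1..<10}. class_nbrs n q c G u j = class_nbrs n q c G v j)"

lemma not_separatedD:
  assumes "\<not> separated n q c G"
  obtains u v where "u \<in> {1..n}" "v \<in> {1..n}" "u \<noteq> v" "profile_clash n q c G u v"
proof -
  obtain u v where "u \<in> {1..n}" "v \<in> {1..n}" "u \<noteq> v" "profile n q c G u = profile n q c G v"
    using assms by (auto simp: separated_def inj_on_def)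
  moreover from this(4) have "profile_clash n q c G u v"
    unfolding profile_def profile_clash_def by simp
  ultimately show ?thesis using that by blast
qed

section \<open>Two vertices and the swapping of their private neighbours\<close>

locale vertex_pair =
  fixes n q c u v :: nat
  assumes u: "u \<in> {1..n}" and v: "v \<in> {1..n}" and uv: "u \<noteq> v"
begin

abbreviation "W \<equiv> {1..n} - {u, v}"

definition differ :: "graph \<Rightarrow> nat \<Rightarrow> bool" where
  "differ G w \<longleftrightarrow> ({u, w} \<in> G) \<noteq> ({v, w} \<in> G)"

definition D :: "graph \<Rightarrow> nat \<Rightarrow> nat set" where
  "D G j = {w \<in> W. differ G w \<and> vclass n q c G w = j}"

text \<open>For \<open>w\<close> in \<open>T\<close> adjacent to exactly one of \<open>u\<close>,
  \<open>v\<close>, toggling both pairs hands the edge over to the other end. Averaging over all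
  \<open>T\<close> plays the role of conditioning on everything except these choices.\<close>

definition swap :: "nat set \<Rightarrow> graph \<Rightarrow> graph" where
  "swap T G = sym_diff G {{a, w} | a w. a \<in> {u, v} \<and> w \<in> T \<and> differ G w}"

lemma swap_iff_end:
  assumes "T \<subseteq> W" "w \<in> W" "a \<in> {u, v}"
  shows "{a, w} \<in> swap T G \<longleftrightarrow> ({a, w} \<in> G) \<noteq> (w \<in> T \<and> differ G w)"
proof -
  have "{a, w} \<in> {{a, w} | a w. a \<in> {u, v} \<and> w \<in> T \<and> differ G w} \<longleftrightarrow> w \<in> T \<and> differ G w"
  proof
    assume "{a, w} \<in> {{a, w} | a w. a \<in> {u, v} \<and> w \<in> T \<and> differ G w}"
    then obtain a' w' where *: "{a, w} = {a', w'}" "a' \<in> {u, v}" "w' \<in> T" "differ G w'" by auto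
    then have "w = w'" using assms by (auto simp: doubleton_eq_iff)
    then show "w \<in> T \<and> differ G w" using * by simp
  qed (use assms in auto)
  then show ?thesis unfolding swap_def by blast
qed

lemma swap_iff_other:
  assumes "T \<subseteq> W" "{x, y} \<subseteq> W \<or> {x, y} \<subseteq> {u, v}"
  shows "{x, y} \<in> swap T G \<longleftrightarrow> {x, y} \<in> G"
proof -
  have "{x, y} \<notin> {{a, w} | a w. a \<in> {u, v} \<and> w \<in> T \<and> differ G w}"
  proof
    assume "{x, y} \<in> {{a, w} | a w. a \<in> {u, v} \<and> w \<in> T \<and> differ G w}"
    then obtain a w where "{x, y} = {a, w}" "a \<in> {u, v}" "w \<in> T" by auto
    then show False using assms by auto
  qed
  then show ?thesis unfolding swap_def by blast
qed

lemma differ_swap: "T \<subseteq> W \<Longrightarrow> w \<in> W \<Longrightarrow> differ (swap T G) w \<longleftrightarrow> differ G w"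
  unfolding differ_def[of "swap T G"] using swap_iff_end[of T w u G] swap_iff_end[of T w v G]
  by (auto simp: differ_def)

lemma swap_swap:
  assumes "T \<subseteq> W"
  shows "swap T (swap T G) = G"
proof -
  have "{{a, w} | a w. a \<in> {u, v} \<and> w \<in> T \<and> differ (swap T G) w} =
        {{a, w} | a w. a \<in> {u, v} \<and> w \<in> T \<and> differ G w}"
    using differ_swap[OF assms] assms by blast
  then show ?thesis unfolding swap_def[of T "swap T G"] by (auto simp: swap_def)
qed

lemma swap_graphs:
  assumes "T \<subseteq> W" "G \<in> graphs n"
  shows "swap T G \<in> graphs n"
proof -
  have "{{a, w} | a w. a \<in> {u, v} \<and> w \<in> T \<and> differ G w} \<subseteq> pairs n"
    using assms(1) u v unfolding mem_pairs_iff subset_iff by blast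
  then show ?thesis using assms(2) unfolding swap_def graphs_def by blast
qed

text \<open>\<open>swap T\<close> is an involution on the graphs and so preserves the uniform
  distribution.\<close>

lemma sum_swap:
  assumes "T \<subseteq> W"
  shows "(\<Sum>G\<in>graphs n. f (swap T G)) = (\<Sum>G\<in>graphs n. f G)"
  by (rule sum.reindex_bij_witness[of _ "swap T" "swap T"])
    (use assms swap_swap swap_graphs in auto)

lemma card_split_uv:
  "card {x \<in> {1..n}. P x} = card {x \<in> W. P x} + of_bool (P u) + of_bool (P v)"
proof -
  have "{x \<in> {1..n}. P x} = {x \<in> W. P x} \<union> ({x \<in> {u}. P x} \<union> {x \<in> {v}. P x})"
    using u v by auto
  moreover have "card ({x \<in> W. P x} \<union> ({x \<in> {u}. P x} \<union> {x \<in> {v}. P x})) =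
      card {x \<in> W. P x} + (card {x \<in> {u}. P x} + card {x \<in> {v}. P x})"
    using uv by (subst card_Un_disjoint, auto)+
  moreover have "card {x \<in> {a}. P x} = of_bool (P a)" for a
  proof -
    have "{x \<in> {a}. P x} = (if P a then {a} else {})" by auto
    then show ?thesis by (simp only: of_bool_def split: if_split) simp
  qed
  ultimately show ?thesis by (simp only: add.assoc)
qed

text \<open>A swap exchanges an edge from \<open>w\<close> to one of \<open>u\<close>,
  \<open>v\<close> for the edge to the other. Only the degrees of \<open>u\<close> and
  \<open>v\<close> themselves can change.\<close>

lemma vdeg_swap:
  assumes "T \<subseteq> W" "w \<in> W"
  shows "vdeg n (swap T G) w = vdeg n G w"
proof -
  have "{x \<in> W. {w, x} \<in> swap T G} = {x \<in> W. {w, x} \<in> G}"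
    using swap_iff_other[OF assms(1), of w] assms(2) by auto
  moreover have "(of_bool ({w, u} \<in> swap T G) + of_bool ({w, v} \<in> swap T G) :: nat) =
      of_bool ({w, u} \<in> G) + of_bool ({w, v} \<in> G)"
    using swap_iff_end[OF assms, of u G] swap_iff_end[OF assms, of v G]
    unfolding differ_def by (auto simp: insert_commute)
  ultimately show ?thesis
    unfolding vdeg_def card_split_uv by simp
qed

lemma vclass_swap:
  "T \<subseteq> W \<Longrightarrow> w \<in> W \<Longrightarrow> vclass n q c (swap T G) w = vclass n q c G w"
  by (simp add: vclass_def vdeg_swap)

text \<open>After the swap, the vertices of \<open>D G j\<close> in \<open>Y\<close> are joined to
  \<open>u\<close> and the others to \<open>v\<close>, while neighbours common to both cancel. Equal
  counts thus force an even split, up to the error 1 that arises when \<open>u\<close> and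
  \<open>v\<close> are adjacent and only one of them lies in class \<open>j\<close>.\<close>

lemma clash_swap_balanced:
  assumes T: "T \<subseteq> W" and G: "G \<in> graphs n" and clash: "profile_clash n q c (swap T G) u v" and j: "j \<in> {1..<10}"
  defines "Y \<equiv> sym_diff T {w \<in> W. {u, w} \<in> G}"
  shows "\<bar>2 * int (card (Y \<inter> D G j)) - int (card (D G j))\<bar> \<le> 1"
proof -
  let ?H = "swap T G"
  have H: "?H \<in> graphs n" using swap_graphs[OF T G] .
  have loops: "{u, u} \<notin> ?H" "{v, v} \<notin> ?H" using H by (auto simp: graphs_def pairs_def)
  let ?A = "{w \<in> W. {u, w} \<in> ?H \<and> vclass n q c ?H w = j}"
  let ?B = "{w \<in> W. {v, w} \<in> ?H \<and> vclass n q c ?H w = j}"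
  let ?I = "?A \<inter> ?B"
  have mem_u: "{u, w} \<in> ?H \<longleftrightarrow> w \<in> Y" if "w \<in> W" "differ G w" for w
    using swap_iff_end[OF T that(1), of u G] that by (auto simp: Y_def)
  have mem_v: "{v, w} \<in> ?H \<longleftrightarrow> w \<notin> Y" if "w \<in> W" "differ G w" for w
    using mem_u[OF that] differ_swap[OF T that(1), of G] that(2) by (auto simp: differ_def)
  have same: "{u, w} \<in> ?H \<longleftrightarrow> {v, w} \<in> ?H" if "w \<in> W" "\<not> differ G w" for w
    using differ_swap[OF T that(1), of G] that(2) by (auto simp: differ_def)
  have A: "?A = ?I \<union> (Y \<inter> D G j)" and B: "?B = ?I \<union> (D G j - Y)"
    using mem_u mem_v same vclass_swap[OF T, of _ G] by (auto simp: D_def)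
  have "finite (D G j)" by (auto simp: D_def)
  have "card ?A = card ?I + card (Y \<inter> D G j)"
  proof (subst A, rule card_Un_disjoint)
    show "?I \<inter> (Y \<inter> D G j) = {}" using mem_v by (auto simp: D_def)
  qed (use \<open>finite (D G j)\<close> in auto)
  moreover have "card ?B = card ?I + card (D G j - Y)"
  proof (subst B, rule card_Un_disjoint)
    show "?I \<inter> (D G j - Y) = {}" using mem_u by (auto simp: D_def)
  qed (use \<open>finite (D G j)\<close> in auto)
  moreover have "card (D G j) = card (Y \<inter> D G j) + card (D G j - Y)"
    using card_Int_Diff[OF \<open>finite (D G j)\<close>, of Y] by (simp add: Int_commute)
  moreover have "\<bar>int (card ?A) - int (card ?B)\<bar> \<le> 1"
  proof -
    have "class_nbrs n q c ?H u j = class_nbrs n q c ?H v j"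
      using clash j by (simp add: profile_clash_def)
    then show ?thesis
      unfolding class_nbrs_def card_split_uv using loops by (auto simp: of_bool_def split: if_splits)
  qed
  ultimately show ?thesis by linarith
qed

text \<open>Shifting \<open>T\<close> by the neighbourhood of \<open>u\<close> is injective and
  turns clashes into sets that split each \<open>D G j\<close> evenly. These nine sets are disjoint,
  so the probabilities multiply.\<close>

lemma card_swaps_clash:
  assumes G: "G \<in> graphs n" and large: "\<And>j. j \<in> {1..<10} \<Longrightarrow> x \<le> card (D G j)"
  shows "real (card {T. T \<subseteq> W \<and> profile_clash n q c (swap T G) u v}) \<le> (2 / sqrt (real x + 1)) ^ 9 * 2 ^ card W"
proof -
  let ?A = "{w \<in> W. {u, w} \<in> G}"
  let ?bal = "\<lambda>j Z. \<bar>2 * int (card Z) - int (card (D G j))\<bar> \<le> 1"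
  let ?Ys = "{Y. Y \<subseteq> W \<and> (\<forall>j\<in>{1..<10}. ?bal j (Y \<inter> D G j))}"
  have "(\<lambda>T. sym_diff T ?A) ` {T. T \<subseteq> W \<and> profile_clash n q c (swap T G) u v} \<subseteq> ?Ys"
  proof (rule image_subsetI)
    fix T assume "T \<in> {T. T \<subseteq> W \<and> profile_clash n q c (swap T G) u v}"
    then have T: "T \<subseteq> W" "profile_clash n q c (swap T G) u v" by auto
    have "sym_diff T ?A \<subseteq> W" using T(1) by blast
    then show "sym_diff T ?A \<in> ?Ys" using clash_swap_balanced[OF T(1) G T(2)] by simp
  qed
  moreover have "inj_on (\<lambda>T. sym_diff T ?A) X" for X
    by (rule inj_onI) blast
  moreover have "finite ?Ys" by (rule finite_subset[of _ "Pow W"]) auto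
  ultimately have "card {T. T \<subseteq> W \<and> profile_clash n q c (swap T G) u v} \<le> card ?Ys"
    by (meson card_inj_on_le)
  then have "real (card {T. T \<subseteq> W \<and> profile_clash n q c (swap T G) u v}) \<le> real (card ?Ys)" by simp
  also have "\<dots> \<le> (2 / sqrt (real x + 1)) ^ card {1..<10::nat} * 2 ^ card W"
  proof (rule card_subsets_blockwise)
    show "disjoint_family_on (D G) {1..<10}" by (auto simp: disjoint_family_on_def D_def)
    fix j :: nat assume j: "j \<in> {1..<10}"
    show "D G j \<subseteq> W" by (auto simp: D_def)
    then have fin: "finite (D G j)" by (rule finite_subset) simp
    have "real (card {Z. Z \<subseteq> D G j \<and> ?bal j Z}) \<le> 2 / sqrt (real (card (D G j)) + 1) * 2 ^ card (D G j)"
      by (rule card_balanced_subsets[OF fin])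
    also have "\<dots> \<le> 2 / sqrt (real x + 1) * 2 ^ card (D G j)"
      using large[OF j] by (intro mult_right_mono divide_left_mono) (auto intro!: mult_pos_pos)
    finally show "real (card {Z. Z \<subseteq> D G j \<and> ?bal j Z}) \<le> 2 / sqrt (real x + 1) * 2 ^ card (D G j)" .
  qed auto
  finally show ?thesis by simp
qed

text \<open>Double counting of pairs of a swap and a graph. Graphs with some small
  \<open>D G j\<close> are charged in full, the others by the bound for swaps.\<close>

lemma card_clash:
  "real (card {G \<in> graphs n. profile_clash n q c G u v}) \<le>
     (2 / sqrt (real x + 1)) ^ 9 * card (graphs n) + real (card {G \<in> graphs n. \<exists>j\<in>{1..<10}. card (D G j) < x})"
proof -
  let ?cl = "\<lambda>G. profile_clash n q c G u v"
  let ?small = "\<lambda>G. \<exists>j\<in>{1..<10}. card (D G j) < x"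
  let ?h = "(2 / sqrt (real x + 1)) ^ 9"
  have "2 ^ card W * real (card {G \<in> graphs n. ?cl G}) = (\<Sum>T\<in>Pow W. \<Sum>G\<in>graphs n. of_bool (?cl G))"
    by (simp add: card_Pow finite_graphs Int_def)
  also have "\<dots> = (\<Sum>T\<in>Pow W. \<Sum>G\<in>graphs n. of_bool (?cl (swap T G)))"
    by (intro sum.cong refl sum_swap[symmetric]) auto
  also have "\<dots> = (\<Sum>G\<in>graphs n. \<Sum>T\<in>Pow W. of_bool (?cl (swap T G)))" by (rule sum.swap)
  also have "\<dots> \<le> (\<Sum>G\<in>graphs n. 2 ^ card W * (?h + of_bool (?small G)))"
  proof (rule sum_mono)
    fix G assume G: "G \<in> graphs n"
    have eq: "(\<Sum>T\<in>Pow W. of_bool (?cl (swap T G))) = real (card {T. T \<subseteq> W \<and> ?cl (swap T G)})"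
      by (simp add: Int_def)
    show "(\<Sum>T\<in>Pow W. of_bool (?cl (swap T G))) \<le> 2 ^ card W * (?h + of_bool (?small G))"
    proof (cases "?small G")
      case False
      then have "(of_bool (?small G) :: real) = 0" by (simp only: of_bool_eq)
      moreover have "real (card {T. T \<subseteq> W \<and> ?cl (swap T G)}) \<le> ?h * 2 ^ card W"
        by (rule card_swaps_clash[OF G]) (use False in \<open>auto simp: not_less\<close>)
      ultimately show ?thesis unfolding eq by (simp only: mult.commute add_0_right)
    next
      case True
      then have small: "(of_bool (?small G) :: real) = 1" by (simp only: of_bool_eq)
      have "card {T. T \<subseteq> W \<and> ?cl (swap T G)} \<le> card (Pow W)" by (intro card_mono) auto
      then have "real (card {T. T \<subseteq> W \<and> ?cl (swap T G)}) \<le> real (card (Pow W))" by (rule of_nat_mono)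
      also have "real (card (Pow W)) = 2 ^ card W * 1" by (simp add: card_Pow)
      also have "\<dots> \<le> 2 ^ card W * (?h + 1)" by (intro mult_left_mono) auto
      finally show ?thesis unfolding eq small .
    qed
  qed
  also have "\<dots> = 2 ^ card W * (?h * card (graphs n) + real (card {G \<in> graphs n. ?small G}))"
    by (simp add: sum.distrib finite_graphs Int_def flip: sum_distrib_left)
  finally show ?thesis by simp
qed

end

section \<open>Lower tails for class sizes\<close>

lemma sum_graphs_shift:
  assumes "Z \<subseteq> pairs n"
  shows "(\<Sum>G\<in>graphs n. f (sym_diff G Z)) = (\<Sum>G\<in>graphs n. f G)"
proof -
  have "sym_diff (sym_diff G Z) Z = G" for G by blast
  moreover have "sym_diff G Z \<in> graphs n" if "G \<in> graphs n" for G
    using that assms by (auto simp: graphs_def)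
  ultimately show ?thesis
    by (intro sum.reindex_bij_witness[of _ "\<lambda>G. sym_diff G Z" "\<lambda>G. sym_diff G Z"]) simp_all
qed

lemma exists_residue_shift:
  fixes q j K :: nat
  assumes "j < q"
  shows "\<exists>r<q. (K + r) mod q = j"
proof -
  have "(K + (j + (q - K mod q)) mod q) mod q = (K mod q + (j + (q - K mod q))) mod q"
    by (simp add: mod_simps)
  also have "K mod q + (j + (q - K mod q)) = j + q"
    using assms mod_less_divisor[of q K] by linarith
  also have "(j + q) mod q = j" using assms by simp
  finally show ?thesis using assms by (intro exI[of _ "(j + (q - K mod q)) mod q"]) simp
qed

context vertex_pair
begin

lemma card_W: "card W = n - 2"
  using u v uv by (simp add: card_Diff_subset)

definition block_shift :: "nat set \<Rightarrow> (nat \<Rightarrow> nat set) \<Rightarrow> graph" where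
  "block_shift V f = {{w, b} | w b. w \<in> V \<and> b \<in> f w}"

context
  fixes R :: "nat set" and j :: nat
  assumes R: "R \<subseteq> W" "card R = q - 1" and j: "j < q"
begin

abbreviation "B \<equiv> insert u R"
abbreviation "V \<equiv> W - R"

text \<open>
  Rerandomise only the edges between \<open>V\<close> and \<open>B\<close>. For different \<open>w \<in> V\<close> these changes are independent, and
  the \<open>q - 1\<close> edges from \<open>w\<close> to \<open>R\<close> suffice to give the degree of \<open>w\<close> any residue modulo \<open>q\<close>.
\<close>

definition hits :: "graph \<Rightarrow> nat \<Rightarrow> nat set \<Rightarrow> bool" where
  "hits G w S \<longleftrightarrow> ((({u, w} \<in> G) \<noteq> (u \<in> S)) \<noteq> ({v, w} \<in> G)) \<and>
     (card {y \<in> {1..n}. ({w, y} \<in> G) \<noteq> (y \<in> S)} + c) mod q = j"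

lemma finite_R: "finite R" using R(1) finite_subset by blast

lemma card_B: "card B = q"
  using R finite_R j by (subst card_insert_disjoint) auto

lemma block_shift_iff:
  assumes "f \<in> V \<rightarrow>\<^sub>E Pow B" "w \<in> V"
  shows "{w, y} \<in> block_shift V f \<longleftrightarrow> y \<in> f w"
proof
  assume "{w, y} \<in> block_shift V f"
  then obtain w' b where *: "{w, y} = {w', b}" "w' \<in> V" "b \<in> f w'" by (auto simp: block_shift_def)
  then have "b \<in> B" using assms(1) by (auto simp: PiE_iff)
  then have "b \<noteq> w" using assms(2) by auto
  then show "y \<in> f w" using * by (auto simp: doubleton_eq_iff)
qed (use assms in \<open>auto simp: block_shift_def\<close>)

lemma block_shift_pairs:
  assumes "f \<in> V \<rightarrow>\<^sub>E Pow B"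
  shows "block_shift V f \<subseteq> pairs n"
proof
  fix e assume "e \<in> block_shift V f"
  then obtain w b where e: "e = {w, b}" "w \<in> V" "b \<in> f w" by (auto simp: block_shift_def)
  then have "b \<in> B" using assms by (auto simp: PiE_iff)
  then have "w \<noteq> b" "w \<in> {1..n}" "b \<in> {1..n}" using e(2) R(1) u by auto
  then show "e \<in> pairs n" using e(1) unfolding mem_pairs_iff by blast
qed

text \<open>Since \<open>V\<close> and \<open>B\<close> are disjoint, the edges at \<open>w\<close>
  are affected by \<open>f w\<close> alone, and \<open>{v, w}\<close> stays fixed because
  \<open>v\<close> is not in \<open>B\<close>. The event at \<open>w\<close> therefore depends only
  on \<open>f w\<close>.\<close>

lemma shift_hits:
  assumes "f \<in> V \<rightarrow>\<^sub>E Pow B" "w \<in> V"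
  shows "differ (sym_diff G (block_shift V f)) w \<and> vclass n q c (sym_diff G (block_shift V f)) w = j \<longleftrightarrow> hits G w (f w)"
proof -
  have mem: "{w, y} \<in> sym_diff G (block_shift V f) \<longleftrightarrow> ({w, y} \<in> G) \<noteq> (y \<in> f w)" for y
    using block_shift_iff[OF assms, of y] by blast
  have fw: "f w \<subseteq> B" using assms by (auto simp: PiE_iff)
  then have "v \<notin> f w" using R(1) uv by auto
  then have "differ (sym_diff G (block_shift V f)) w \<longleftrightarrow> ((({u, w} \<in> G) \<noteq> (u \<in> f w)) \<noteq> ({v, w} \<in> G))"
    unfolding differ_def using mem[of u] mem[of v] by (simp add: insert_commute)
  then show ?thesis unfolding hits_def vclass_def vdeg_def mem by simp
qed

text \<open>Adjacency to \<open>u\<close> is settled first, opposite to adjacency to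
  \<open>v\<close>. The number of neighbours in \<open>R\<close> can then be any of 0 to
  \<open>q - 1\<close>, which covers all residues of the degree.\<close>

lemma exists_hit:
  assumes "w \<in> V"
  shows "\<exists>S\<in>Pow B. hits G w S"
proof -
  define a where "a \<longleftrightarrow> {v, w} \<notin> G"
  define b0 where "b0 = card {y \<in> {1..n} - B. {w, y} \<in> G}"
  obtain r where r: "r < q" "(b0 + of_bool a + c + r) mod q = j"
    using exists_residue_shift[OF j] by blast
  then have "r \<le> card R" using R by simp
  then obtain R' where R': "R' \<subseteq> R" "card R' = r" by (meson obtain_subset_with_card_n)
  \<comment> \<open>\<open>T\<close> is the desired neighbourhood of \<open>w\<close> inside
    \<open>B\<close>; \<open>S\<close> consists of the toggles that produce it.\<close>
  define T where "T = (if a then insert u R' else R')"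
  define S where "S = {y \<in> B. ({w, y} \<in> G) \<noteq> (y \<in> T)}"
  have uR: "u \<notin> R" using R(1) by auto
  have finR': "finite R'" using R'(1) finite_R finite_subset by blast
  have cT: "card T = of_bool a + r" using R' uR finR' by (auto simp: T_def card_insert_if)
  have finT: "finite T" using finR' by (simp add: T_def)
  have TB: "T \<subseteq> B" using R' by (auto simp: T_def)
  have BN: "B \<subseteq> {1..n}" using R(1) u by auto
  have uT: "u \<in> T \<longleftrightarrow> a" using R' uR by (auto simp: T_def)
  have eq: "{y \<in> {1..n}. ({w, y} \<in> G) \<noteq> (y \<in> S)} = T \<union> {y \<in> {1..n} - B. {w, y} \<in> G}"
    using TB BN by (auto simp: S_def)
  have "card {y \<in> {1..n}. ({w, y} \<in> G) \<noteq> (y \<in> S)} = card T + b0"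
    unfolding eq b0_def using TB finT by (intro card_Un_disjoint) auto
  then have "(card {y \<in> {1..n}. ({w, y} \<in> G) \<noteq> (y \<in> S)} + c) mod q = j"
    using r(2) cT by (simp add: ac_simps)
  moreover have "u \<in> S \<longleftrightarrow> ({u, w} \<in> G) \<noteq> a" using uT by (auto simp: S_def insert_commute)
  then have "(({u, w} \<in> G) \<noteq> (u \<in> S)) \<noteq> ({v, w} \<in> G)" by (auto simp: a_def)
  ultimately have "hits G w S" by (simp add: hits_def)
  moreover have "S \<subseteq> B" by (auto simp: S_def)
  ultimately show ?thesis by blast
qed

lemma sum_hits_le:
  assumes "w \<in> V"
  shows "(\<Sum>S\<in>Pow B. if hits G w S then 1/2 else 1 :: real) \<le> 2 ^ q - 1/2"
proof -
  obtain S0 where S0: "S0 \<in> Pow B" "hits G w S0" using exists_hit[OF assms] by blast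
  have fin: "finite (Pow B)" using finite_R by simp
  have "(\<Sum>S\<in>Pow B. if hits G w S then 1/2 else 1 :: real) =
      1/2 + (\<Sum>S\<in>Pow B - {S0}. if hits G w S then 1/2 else 1)"
    using S0 fin by (subst sum.remove[of _ S0]) auto
  also have "\<dots> \<le> 1/2 + (\<Sum>S\<in>Pow B - {S0}. 1)"
    by (intro add_left_mono sum_mono) auto
  also have "\<dots> = 1/2 + (real (card (Pow B)) - 1)"
    using S0(1) fin by (simp add: card_Diff_singleton of_nat_diff card_Pow)
  also have "real (card (Pow B)) = 2 ^ q"
    using card_B finite_R by (subst card_Pow) simp_all
  finally show ?thesis by simp
qed

text \<open>An exponential moment argument. A graph is weighted by one half for each vertex of
  \<open>V\<close> that lies in \<open>D G j\<close>. Averaged over \<open>f\<close>, the weight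
  factorises over \<open>V\<close>, and one hit among the \<open>2 ^ q\<close> subsets gives each
  factor at most \<open>1 - 1 / 2 ^ Suc q\<close>. A graph with \<open>card (D G j) < x\<close> has
  weight at least \<open>(1/2) ^ x\<close>.\<close>

lemma card_D_small_aux:
  "real (card {G \<in> graphs n. card (D G j) < x}) \<le> 2 ^ x * (1 - 1 / 2 ^ Suc q) ^ card V * card (graphs n)"
proof -
  let ?E = "\<lambda>G w. differ G w \<and> vclass n q c G w = j"
  let ?\<phi> = "\<lambda>G. \<Prod>w\<in>V. if ?E G w then 1/2 else 1 :: real"
  let ?F = "V \<rightarrow>\<^sub>E Pow B"
  have finV: "finite V" by simp
  have finB: "finite B" using finite_R by simp
  have cardF: "card ?F = (2 ^ q) ^ card V"
    using card_B finB by (simp add: card_PiE card_Pow)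
  have \<phi>: "?\<phi> G = (1/2) ^ card {w \<in> V. ?E G w}" for G
    by (simp add: prod.If_cases Int_def)
  have "(2 ^ q) ^ card V * (\<Sum>G\<in>graphs n. ?\<phi> G) = (\<Sum>f\<in>?F. \<Sum>G\<in>graphs n. ?\<phi> G)"
    by (simp only: sum_constant cardF of_nat_power of_nat_numeral)
  also have "\<dots> = (\<Sum>f\<in>?F. \<Sum>G\<in>graphs n. ?\<phi> (sym_diff G (block_shift V f)))"
    by (intro sum.cong refl sum_graphs_shift[symmetric] block_shift_pairs)
  also have "\<dots> = (\<Sum>f\<in>?F. \<Sum>G\<in>graphs n. \<Prod>w\<in>V. if hits G w (f w) then 1/2 else 1)"
    by (intro sum.cong prod.cong refl if_cong shift_hits)
  also have "\<dots> = (\<Sum>G\<in>graphs n. \<Sum>f\<in>?F. \<Prod>w\<in>V. if hits G w (f w) then 1/2 else 1)"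
    by (rule sum.swap)
  also have "\<dots> = (\<Sum>G\<in>graphs n. \<Prod>w\<in>V. \<Sum>S\<in>Pow B. if hits G w S then 1/2 else 1)"
    using finB by (intro sum.cong refl prod_sum_PiE[symmetric]) auto
  also have "\<dots> \<le> (\<Sum>G\<in>graphs n. \<Prod>w\<in>V. 2 ^ q - 1/2)"
    by (intro sum_mono prod_mono conjI sum_hits_le sum_nonneg) auto
  also have "\<dots> = (2 ^ q - 1/2) ^ card V * card (graphs n)" by simp
  also have "(2 ^ q - 1/2 :: real) = 2 ^ q * (1 - 1 / 2 ^ Suc q)" by (simp add: field_simps)
  finally have "(2 ^ q) ^ card V * (\<Sum>G\<in>graphs n. ?\<phi> G) \<le>
      (2 ^ q) ^ card V * ((1 - 1 / 2 ^ Suc q) ^ card V * card (graphs n))"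
    by (simp only: power_mult_distrib mult.assoc)
  then have main: "(\<Sum>G\<in>graphs n. ?\<phi> G) \<le> (1 - 1 / 2 ^ Suc q) ^ card V * card (graphs n)"
    by (rule mult_left_le_imp_le) simp
  have "(1/2) ^ x * real (card {G \<in> graphs n. card (D G j) < x}) = (\<Sum>G\<in>{G \<in> graphs n. card (D G j) < x}. (1/2) ^ x)"
    by simp
  also have "\<dots> \<le> (\<Sum>G\<in>{G \<in> graphs n. card (D G j) < x}. ?\<phi> G)"
  proof (rule sum_mono)
    fix G assume "G \<in> {G \<in> graphs n. card (D G j) < x}"
    then have "card (D G j) < x" by simp
    moreover have "card {w \<in> V. ?E G w} \<le> card (D G j)"
      by (intro card_mono) (auto simp: D_def)
    ultimately have "card {w \<in> V. ?E G w} \<le> x" by simp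
    then show "(1/2) ^ x \<le> ?\<phi> G" unfolding \<phi> by (intro power_decreasing) auto
  qed
  also have "\<dots> \<le> (\<Sum>G\<in>graphs n. ?\<phi> G)"
    unfolding \<phi> by (intro sum_mono2) (auto simp: finite_graphs)
  also note main
  finally show ?thesis by (simp add: field_simps)
qed

end

lemma card_D_small:
  assumes "j < q" "q < n"
  shows "real (card {G \<in> graphs n. card (D G j) < x}) \<le> 2 ^ x * (1 - 1 / 2 ^ Suc q) ^ (n - Suc q) * card (graphs n)"
proof -
  have "q - 1 \<le> card W" using assms by (simp only: card_W)
  then obtain R where R: "R \<subseteq> W" "card R = q - 1" by (meson obtain_subset_with_card_n)
  have "card (W - R) = n - Suc q"
    using assms card_Diff_subset[OF finite_subset[OF R(1)] R(1)] unfolding card_W R(2) by simp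
  then show ?thesis using card_D_small_aux[OF R assms(1), of x] by simp
qed

lemma card_clash_bound:
  assumes "10 \<le> q" "q < n"
  shows "real (card {G \<in> graphs n. profile_clash n q c G u v}) \<le>
    ((2 / sqrt (real x + 1)) ^ 9 + 9 * (2 ^ x * (1 - 1 / 2 ^ Suc q) ^ (n - Suc q))) * card (graphs n)"
proof -
  let ?b = "2 ^ x * (1 - 1 / 2 ^ Suc q) ^ (n - Suc q) * real (card (graphs n))"
  have "{G \<in> graphs n. \<exists>j\<in>{1..<10}. card (D G j) < x} = (\<Union>j\<in>{1..<10}. {G \<in> graphs n. card (D G j) < x})"
    by auto
  then have "card {G \<in> graphs n. \<exists>j\<in>{1..<10}. card (D G j) < x} \<le> (\<Sum>j\<in>{1..<10}. card {G \<in> graphs n. card (D G j) < x})"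
    by (simp only: card_UN_le finite_atLeastLessThan)
  then have "real (card {G \<in> graphs n. \<exists>j\<in>{1..<10}. card (D G j) < x}) \<le> real (\<Sum>j\<in>{1..<10}. card {G \<in> graphs n. card (D G j) < x})"
    by (rule of_nat_mono)
  also have "\<dots> \<le> (\<Sum>j\<in>{1..<10::nat}. ?b)"
    unfolding of_nat_sum using assms by (intro sum_mono card_D_small) auto
  also have "\<dots> = 9 * ?b" by simp
  finally show ?thesis using card_clash[of x] by (simp add: algebra_simps)
qed

end

text \<open>Union bound over the ordered pairs of vertices, with empty events on the
  diagonal.\<close>

lemma card_not_separated:
  assumes "10 \<le> q" "q < n"
  shows "real (card {G \<in> graphs n. \<not> separated n q c G}) \<le> (real n)\<^sup>2 *
    ((2 / sqrt (real x + 1)) ^ 9 + 9 * (2 ^ x * (1 - 1 / 2 ^ Suc q) ^ (n - Suc q))) * card (graphs n)"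
proof -
  let ?b = "((2 / sqrt (real x + 1)) ^ 9 + 9 * (2 ^ x * (1 - 1 / 2 ^ Suc q) ^ (n - Suc q))) * real (card (graphs n))"
  let ?C = "\<lambda>p. if fst p \<noteq> snd p then {G \<in> graphs n. profile_clash n q c G (fst p) (snd p)} else {}"
  have "0 \<le> (1 - 1 / 2 ^ Suc q :: real)"
    using one_le_power[of "2::real" "Suc q"] by (simp add: field_simps)
  then have b: "0 \<le> ?b" by simp
  have "{G \<in> graphs n. \<not> separated n q c G} \<subseteq> (\<Union>p\<in>{1..n} \<times> {1..n}. ?C p)"
  proof
    fix G assume G: "G \<in> {G \<in> graphs n. \<not> separated n q c G}"
    then obtain u v where "u \<in> {1..n}" "v \<in> {1..n}" "u \<noteq> v" "profile_clash n q c G u v"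
      using not_separatedD by blast
    then show "G \<in> (\<Union>p\<in>{1..n} \<times> {1..n}. ?C p)" using G by (intro UN_I[of "(u, v)"]) auto
  qed
  then have "card {G \<in> graphs n. \<not> separated n q c G} \<le> card (\<Union>p\<in>{1..n} \<times> {1..n}. ?C p)"
    by (intro card_mono) (auto simp: finite_graphs)
  also have "\<dots> \<le> (\<Sum>p\<in>{1..n} \<times> {1..n}. card (?C p))" by (rule card_UN_le) simp
  finally have "real (card {G \<in> graphs n. \<not> separated n q c G}) \<le> real (\<Sum>p\<in>{1..n} \<times> {1..n}. card (?C p))"
    by (rule of_nat_mono)
  also have "\<dots> \<le> (\<Sum>p\<in>{1..n} \<times> {1..n}. ?b)"
    unfolding of_nat_sum
  proof (rule sum_mono)
    fix p assume p: "p \<in> {1..n} \<times> {1..n}"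
    show "real (card (?C p)) \<le> ?b"
    proof (cases "fst p = snd p")
      case False
      then interpret vertex_pair n q c "fst p" "snd p" using p by unfold_locales auto
      show ?thesis using card_clash_bound[OF assms, of x] False by simp
    qed (use b in simp)
  qed
  also have "\<dots> = (real n)\<^sup>2 * ?b" by (simp add: power2_eq_square card_cartesian_product)
  finally show ?thesis by (simp only: mult.assoc)
qed

text \<open>With \<open>x\<close> about \<open>sqrt n\<close>, nine balanced splits cost order
  \<open>n powr (- 9/4)\<close>, which beats the \<open>n\<^sup>2\<close> pairs; eight would leave a
  bounded term only. In the other term, \<open>2 powr sqrt n\<close> is overcome by exponential
  decay.\<close>

lemma separation_bound_tendsto:
  fixes \<rho> :: real
  assumes "0 < \<rho>" "\<rho> < 1"
  shows "(\<lambda>n. (real n)\<^sup>2 * ((2 / sqrt (real (nat \<lfloor>sqrt n\<rfloor>) + 1)) ^ 9 + 9 * (2 ^ nat \<lfloor>sqrt n\<rfloor> * \<rho> ^ (n - Suc q)))) \<longlonglongrightarrow> 0"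
proof (rule real_tendsto_sandwich)
  define a where "a = - ln \<rho>"
  have a: "0 < a" using assms by (simp add: a_def ln_less_zero)
  let ?up = "\<lambda>n. (real n)\<^sup>2 * ((2 / sqrt (sqrt n)) ^ 9 + 9 * (2 powr sqrt n * (exp (- a * real n) / \<rho> ^ Suc q)))"
  show "\<forall>\<^sub>F n in sequentially. 0 \<le> (real n)\<^sup>2 * ((2 / sqrt (real (nat \<lfloor>sqrt n\<rfloor>) + 1)) ^ 9 + 9 * (2 ^ nat \<lfloor>sqrt n\<rfloor> * \<rho> ^ (n - Suc q)))"
    using assms by (intro always_eventually allI mult_nonneg_nonneg add_nonneg_nonneg) auto
  show "\<forall>\<^sub>F n in sequentially. (real n)\<^sup>2 * ((2 / sqrt (real (nat \<lfloor>sqrt n\<rfloor>) + 1)) ^ 9 + 9 * (2 ^ nat \<lfloor>sqrt n\<rfloor> * \<rho> ^ (n - Suc q))) \<le> ?up n"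
    using eventually_gt_at_top[of q]
  proof eventually_elim
    case (elim n)
    have fl: "real (nat \<lfloor>sqrt n\<rfloor>) \<le> sqrt n" "sqrt n \<le> real (nat \<lfloor>sqrt n\<rfloor>) + 1" by (simp_all add: of_nat_floor)
    have pos: "0 < sqrt n" using elim by simp
    have "2 / sqrt (real (nat \<lfloor>sqrt n\<rfloor>) + 1) \<le> 2 / sqrt (sqrt n)"
      by (intro frac_le real_sqrt_le_mono fl(2)) (use pos in auto)
    then have 1: "(2 / sqrt (real (nat \<lfloor>sqrt n\<rfloor>) + 1)) ^ 9 \<le> (2 / sqrt (sqrt n)) ^ 9"
      by (intro power_mono) auto
    have "(2::real) ^ nat \<lfloor>sqrt n\<rfloor> = 2 powr real (nat \<lfloor>sqrt n\<rfloor>)" by (rule powr_realpow[symmetric]) simp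
    also have "\<dots> \<le> 2 powr sqrt n" by (intro powr_mono fl(1)) simp
    finally have 2: "(2::real) ^ nat \<lfloor>sqrt n\<rfloor> \<le> 2 powr sqrt n" .
    have "\<rho> ^ (n - Suc q) * \<rho> ^ Suc q = \<rho> ^ n" using elim by (simp flip: power_add del: power_Suc)
    also have "\<rho> ^ n = exp (- a * real n)" using assms(1) by (simp add: a_def exp_of_nat2_mult)
    finally have 3: "\<rho> ^ (n - Suc q) = exp (- a * real n) / \<rho> ^ Suc q" using assms(1) by (simp add: field_simps)
    show ?case
      unfolding 3 using assms(1) by (intro mult_left_mono add_mono mult_right_mono 1 2) auto
  qed
  show "?up \<longlonglongrightarrow> 0"
  proof -
    have "(\<lambda>n. (real n)\<^sup>2 * (2 / sqrt (sqrt n)) ^ 9) \<longlonglongrightarrow> 0" by real_asymp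
    moreover have "(\<lambda>n. (real n)\<^sup>2 * (2 powr sqrt n * exp (- a * real n))) \<longlonglongrightarrow> 0"
      using a by real_asymp
    ultimately have "(\<lambda>n. (real n)\<^sup>2 * (2 / sqrt (sqrt n)) ^ 9 + (9 / \<rho> ^ Suc q) * ((real n)\<^sup>2 * (2 powr sqrt n * exp (- a * real n)))) \<longlonglongrightarrow> 0 + (9 / \<rho> ^ Suc q) * 0"
      by (intro tendsto_add tendsto_mult tendsto_const)
    then show ?thesis by (simp add: algebra_simps)
  qed
qed (rule tendsto_const)

text \<open>The bound is uniform in \<open>c\<close> because the shift is selected afterwards and
  depends on \<open>n\<close>.\<close>

lemma eventually_separated:
  fixes \<delta> :: real
  assumes "10 \<le> q" "0 < \<delta>"
  shows "\<forall>\<^sub>F n in sequentially. \<forall>c. real (card {G \<in> graphs n. \<not> separated n q c G}) \<le> \<delta> * card (graphs n)"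
proof -
  have "(1 - 1 / 2 ^ Suc q :: real) < 1" "0 < (1 - 1 / 2 ^ Suc q :: real)"
    using one_less_power[of "2::real" "Suc q"] by (simp_all add: field_simps)
  from order_tendstoD(2)[OF separation_bound_tendsto[OF this(2,1), of q] assms(2)] eventually_gt_at_top[of q]
  show ?thesis
  proof eventually_elim
    case (elim n)
    show ?case
    proof
      fix c
      show "real (card {G \<in> graphs n. \<not> separated n q c G}) \<le> \<delta> * card (graphs n)"
        by (rule order_trans[OF card_not_separated[OF assms(1) elim(2), of c "nat \<lfloor>sqrt n\<rfloor>"]
              mult_right_mono[OF less_imp_le[OF elim(1)]]]) simp
    qed
  qed
qed

section \<open>Choice of the parameters\<close>

text \<open>Steps of length \<open>\<bar>\<eta>\<bar>\<close> start at the fractional part of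
  \<open>y\<close> and go down to 0 if \<open>\<eta>\<close> is positive, up to 1 otherwise;
  \<open>z\<close> is the integer approached. The number of steps is bounded independently of
  \<open>y\<close>, and the lower bound on \<open>z\<close> later keeps an exponent of 2
  nonnegative.\<close>

lemma approx_multiples_mod_one:
  fixes \<eta> :: real
  assumes "\<eta> \<noteq> 0"
  obtains J :: nat where
    "\<And>y. \<exists>j\<le>J. \<exists>z\<ge>\<lfloor>y\<rfloor>. 0 \<le> y - of_int z - real j * \<eta> \<and> y - of_int z - real j * \<eta> \<le> \<bar>\<eta>\<bar>"
proof (cases "\<eta> > 0")
  case True
  have "\<exists>j\<le>nat \<lfloor>1 / \<eta>\<rfloor>. \<exists>z\<ge>\<lfloor>y\<rfloor>. 0 \<le> y - of_int z - real j * \<eta> \<and> y - of_int z - real j * \<eta> \<le> \<bar>\<eta>\<bar>" for y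
  proof -
    define j where "j = nat \<lfloor>frac y / \<eta>\<rfloor>"
    have "0 \<le> frac y / \<eta>" using True by simp
    then have rj: "real j = of_int \<lfloor>frac y / \<eta>\<rfloor>" by (simp add: j_def)
    have "real j \<le> frac y / \<eta>" "frac y / \<eta> \<le> real j + 1" unfolding rj by linarith+
    then have b: "real j * \<eta> \<le> frac y" "frac y \<le> real j * \<eta> + \<eta>" using True by (simp_all add: field_simps)
    have "frac y / \<eta> \<le> 1 / \<eta>" using True frac_lt_1[of y] by (intro divide_right_mono) auto
    then have "j \<le> nat \<lfloor>1 / \<eta>\<rfloor>" unfolding j_def by (intro nat_mono floor_mono)
    then show ?thesis using b True
      by (intro exI[of _ j] conjI exI[of _ "\<lfloor>y\<rfloor>"]) (auto simp: frac_def)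
  qed
  then show thesis by (rule that)
next
  case False
  define \<mu> where "\<mu> = - \<eta>"
  have \<mu>: "0 < \<mu>" using False assms by (simp add: \<mu>_def)
  have "\<exists>j\<le>nat \<lceil>1 / \<mu>\<rceil>. \<exists>z\<ge>\<lfloor>y\<rfloor>. 0 \<le> y - of_int z - real j * \<eta> \<and> y - of_int z - real j * \<eta> \<le> \<bar>\<eta>\<bar>" for y
  proof -
    define j where "j = nat \<lceil>(1 - frac y) / \<mu>\<rceil>"
    have "0 \<le> (1 - frac y) / \<mu>" using \<mu> frac_lt_1[of y] by simp
    then have rj: "real j = of_int \<lceil>(1 - frac y) / \<mu>\<rceil>" unfolding j_def by linarith
    have "(1 - frac y) / \<mu> \<le> real j" "real j \<le> (1 - frac y) / \<mu> + 1" unfolding rj by linarith+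
    then have b: "1 - frac y \<le> real j * \<mu>" "real j * \<mu> \<le> 1 - frac y + \<mu>" using \<mu> by (simp_all add: field_simps)
    have "(1 - frac y) / \<mu> \<le> 1 / \<mu>" using \<mu> by (intro divide_right_mono) auto
    then have "j \<le> nat \<lceil>1 / \<mu>\<rceil>" unfolding j_def by (intro nat_mono ceiling_mono)
    then show ?thesis using b \<mu>
      by (intro exI[of _ j] conjI exI[of _ "\<lfloor>y\<rfloor> + 1"]) (auto simp: frac_def \<mu>_def)
  qed
  then show thesis by (rule that)
qed

text \<open>In logarithms to base 2, \<open>a * \<theta> + s\<close> has to lie just below
  \<open>log 2 N\<close>. A tiny nonzero combination of \<open>\<theta>\<close> and 1 has multiples
  that come close enough. The bound \<open>A\<close> on the power of \<open>p\<close> is essential: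
  it makes \<open>m\<close> negligible against \<open>N\<close> later.\<close>

lemma prime_power_two_power_approx:
  fixes p :: nat and \<epsilon> :: real
  assumes p: "odd p" "1 < p" and \<epsilon>: "0 < \<epsilon>"
  obtains A :: nat where
    "\<forall>\<^sub>F N in sequentially. \<exists>a\<le>A. \<exists>s. p ^ a * 2 ^ s \<le> N \<and> real N \<le> (1 + \<epsilon>) * real (p ^ a * 2 ^ s)"
proof -
  define \<theta> where "\<theta> = log 2 (real p)"
  have \<theta>: "1 \<le> \<theta>" using p by (simp add: \<theta>_def le_log_iff)
  have lp: "0 < log 2 (1 + \<epsilon>)" using \<epsilon> by simp
  obtain K :: nat where K: "0 < K" "1 / real K < log 2 (1 + \<epsilon>)"
    using reals_Archimedean[OF lp] by (metis inverse_eq_divide zero_less_Suc)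
  \<comment> \<open>\<open>K\<close> was chosen so that the approximation error stays below
    \<open>log 2 (1 + \<epsilon>)\<close>, the logarithm of the admissible ratio.\<close>
  obtain h k :: int where hk: "0 < k" "\<bar>of_int k * \<theta> - of_int h\<bar> < 1 / K"
    using Dirichlet_approx[OF K(1), of \<theta>] by blast
  have K1: "1 / real K \<le> 1" using K(1) by simp
  have "1 * 1 \<le> of_int k * \<theta>" using hk(1) \<theta> by (intro mult_mono) auto
  then have h: "0 \<le> h" using hk(2) K1 by linarith
  define kn hn where "kn = nat k" and "hn = nat h"
  have kn: "real kn = of_int k" "0 < kn" and hn: "real hn = of_int h" using hk(1) h by (auto simp: kn_def hn_def)
  define \<eta> where "\<eta> = real kn * \<theta> - real hn"
  have p\<theta>: "2 powr \<theta> = real p" using p by (simp add: \<theta>_def)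
  have "\<eta> \<noteq> 0"
  proof
    assume "\<eta> = 0"
    then have "2 powr (\<theta> * real kn) = 2 powr real hn" by (simp add: \<eta>_def mult.commute)
    then have "real p ^ kn = 2 ^ hn" using p by (simp add: powr_powr[symmetric] p\<theta> powr_realpow)
    then have eq: "p ^ kn = 2 ^ hn" by (metis of_nat_eq_iff of_nat_numeral of_nat_power)
    have "odd (p ^ kn)" using p by simp
    then have "hn = 0" using eq by (cases hn) auto
    then show False using eq p kn by simp
  qed
  then obtain J where J: "\<And>y. \<exists>j\<le>J. \<exists>z\<ge>\<lfloor>y\<rfloor>. 0 \<le> y - of_int z - real j * \<eta> \<and> y - of_int z - real j * \<eta> \<le> \<bar>\<eta>\<bar>"
    using approx_multiples_mod_one by metis
  have "\<exists>a\<le>J * kn. \<exists>s. p ^ a * 2 ^ s \<le> N \<and> real N \<le> (1 + \<epsilon>) * real (p ^ a * 2 ^ s)"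
    if N: "2 ^ (J * hn) \<le> N" for N
  proof -
    have N0: "0 < N" using N by (metis gr0I not_less zero_less_numeral zero_less_power)
    define y where "y = log 2 (real N)"
    have yN: "2 powr y = real N" using N0 by (simp add: y_def)
    have "real (J * hn) \<le> y" using N N0 unfolding y_def
      by (metis le_log2_of_power)
    then have fl: "int (J * hn) \<le> \<lfloor>y\<rfloor>" by (simp add: le_floor_iff)
    obtain j z where jz: "j \<le> J" "\<lfloor>y\<rfloor> \<le> z" "0 \<le> y - of_int z - real j * \<eta>" "y - of_int z - real j * \<eta> \<le> \<bar>\<eta>\<bar>"
      using J[of y] by blast
    \<comment> \<open>Taking \<open>j\<close> copies of \<open>\<eta>\<close> means the power
      \<open>j * kn\<close> of \<open>p\<close> and a division by \<open>2 ^ (j * hn)\<close>. The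
      lower bound on \<open>N\<close> ensures that this leaves a nonnegative exponent.\<close>
    define s where "s = nat (z - int (j * hn))"
    have "j * hn \<le> J * hn" using jz(1) by simp
    then have "int (j * hn) \<le> z" using fl jz(2) by linarith
    then have s: "real s = of_int z - real j * real hn" by (simp add: s_def)
    define e where "e = of_int z + real j * \<eta>"
    have "real (p ^ (j * kn) * 2 ^ s) = (2 powr \<theta>) powr real (j * kn) * 2 powr real s"
      unfolding p\<theta> using p by (subst (1 2) powr_realpow) auto
    also have "\<dots> = 2 powr (\<theta> * real (j * kn) + real s)" by (simp add: powr_powr powr_add)
    also have "\<theta> * real (j * kn) + real s = e" by (simp add: e_def s \<eta>_def algebra_simps)
    finally have val: "real (p ^ (j * kn) * 2 ^ s) = 2 powr e" .
    have "2 powr e \<le> 2 powr y" using jz(3) by (simp add: e_def)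
    then have 1: "p ^ (j * kn) * 2 ^ s \<le> N" using val yN by (metis of_nat_le_iff)
    have "\<bar>\<eta>\<bar> < log 2 (1 + \<epsilon>)" using hk(2) K(2) by (simp add: \<eta>_def kn hn)
    then have "2 powr y \<le> 2 powr (e + log 2 (1 + \<epsilon>))" using jz(4) by (simp add: e_def)
    also have "\<dots> = (1 + \<epsilon>) * 2 powr e" using \<epsilon> by (simp add: powr_add)
    finally have 2: "real N \<le> (1 + \<epsilon>) * real (p ^ (j * kn) * 2 ^ s)" using val yN by simp
    show ?thesis using 1 2 jz(1) by (intro exI[of _ "j * kn"] conjI exI[of _ s]) auto
  qed
  then show thesis
    by (intro that[of "J * kn"] eventually_mono[OF eventually_ge_at_top[of "2 ^ (J * hn)"]])
qed

lemma totient_prime_power_ge: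
  assumes "prime p"
  shows "(1 - 1 / real p) * real (p ^ a) \<le> real (totient (p ^ a))"
proof (cases a)
  case 0
  then show ?thesis by simp
next
  case (Suc b)
  have "0 < p" using assms prime_gt_0_nat by blast
  then show ?thesis
    using totient_prime_power_Suc[OF assms, of b] Suc by (simp add: of_nat_diff field_simps)
qed

text \<open>A prime above \<open>1 / \<delta>\<close> makes the totient loss at most a fraction
  \<open>\<delta>\<close>. As \<open>m\<close> stays bounded by \<open>p ^ A\<close>, rounding
  \<open>2 ^ s\<close> down to a multiple of \<open>m\<close> costs at most the constant
  \<open>m * m\<close> in \<open>m * m * t\<close>.\<close>

lemma eventually_code_parameters:
  fixes \<delta> :: real
  assumes \<delta>: "0 < \<delta>" "\<delta> < 1"
  shows "\<forall>\<^sub>F N in sequentially. \<exists>m t s. 0 < m \<and> 0 < t \<and> m * t \<le> 2 ^ s \<and> m * (2 ^ s - 1) \<le> N \<and>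
    (1 - \<delta>) * real N \<le> real (m * m * t) \<and> (1 - \<delta>) * real (m * m * t) \<le> real (m * t * totient m)"
proof -
  obtain p where p: "prime p" "max 2 (nat \<lceil>1 / \<delta>\<rceil>) < p" using bigger_prime by blast
  have "odd p" using p by (simp add: prime_odd_nat)
  have "1 / \<delta> \<le> real p" using p(2) by linarith
  then have p\<delta>: "1 / real p \<le> \<delta>" using \<delta>(1) p(2) by (simp add: field_simps)
  have p0: "0 < p" "1 < p" using p(2) by auto
  obtain A where A: "\<forall>\<^sub>F N in sequentially. \<exists>a\<le>A. \<exists>s. p ^ a * 2 ^ s \<le> N \<and> real N \<le> (1 + \<delta> / 2) * real (p ^ a * 2 ^ s)"
    using prime_power_two_power_approx[OF \<open>odd p\<close> p0(2), of "\<delta> / 2"] \<delta> by auto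
  have "\<forall>\<^sub>F N in sequentially. real (p ^ A * p ^ A) \<le> \<delta> / 2 * real N"
    using \<delta> by real_asymp
  with A eventually_gt_at_top[of 0] show ?thesis
  proof eventually_elim
    case (elim N)
    obtain a s where as: "a \<le> A" "p ^ a * 2 ^ s \<le> N" "real N \<le> (1 + \<delta> / 2) * real (p ^ a * 2 ^ s)"
      using elim by blast
    define m where "m = p ^ a"
    define t where "t = 2 ^ s div m"
    have m: "0 < m" using p0 by (simp add: m_def)
    have mt: "m * t \<le> 2 ^ s" by (simp add: t_def)
    have "2 ^ s < m * t + m"
      using m mod_less_divisor[of m "2 ^ s"] mult_div_mod_eq[of m "2 ^ s"] unfolding t_def by linarith
    then have "m * 2 ^ s \<le> m * (m * t + m)" by simp
    then have "m * 2 ^ s \<le> m * m * t + m * m" by (simp add: algebra_simps)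
    then have 1: "real (m * 2 ^ s) \<le> real (m * m * t) + real (m * m)" by (metis of_nat_add of_nat_le_iff)
    have "m \<le> p ^ A" unfolding m_def using as(1) p0 by (intro power_increasing) auto
    then have "m * m \<le> p ^ A * p ^ A" by (rule mult_le_mono) fact
    then have "real (m * m) \<le> real (p ^ A * p ^ A)" by (rule of_nat_mono)
    then have 2: "real (m * m) \<le> \<delta> / 2 * real N" using elim by linarith
    have "(1 - \<delta> / 2) * real N \<le> (1 - \<delta> / 2) * ((1 + \<delta> / 2) * real (m * 2 ^ s))"
      using as(3) \<delta> unfolding m_def by (intro mult_left_mono) auto
    also have "\<dots> = (1 - (\<delta> / 2)\<^sup>2) * real (m * 2 ^ s)" by (simp add: power2_eq_square field_simps)
    also have "\<dots> \<le> 1 * real (m * 2 ^ s)" by (intro mult_right_mono) auto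
    finally have 3: "(1 - \<delta>) * real N \<le> real (m * m * t)" using 1 2 by (simp add: algebra_simps)
    have "0 < (1 - \<delta>) * real N" using \<delta> elim by simp
    then have "0 < real (m * m * t)" using 3 by linarith
    then have t: "0 < t" by (cases t) auto
    have "m * (2 ^ s - 1) \<le> m * 2 ^ s" by simp
    then have 4: "m * (2 ^ s - 1) \<le> N" using as(2) unfolding m_def by linarith
    have "(1 - \<delta>) * real m \<le> (1 - 1 / real p) * real m" using p\<delta> by (intro mult_right_mono) auto
    also have "\<dots> \<le> real (totient m)" unfolding m_def by (rule totient_prime_power_ge[OF p(1)])
    finally have "real (m * t) * ((1 - \<delta>) * real m) \<le> real (m * t) * real (totient m)"
      by (intro mult_left_mono) auto
    then have 5: "(1 - \<delta>) * real (m * m * t) \<le> real (m * t * totient m)" by (simp add: algebra_simps)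
    show ?case using m t mt 3 4 5 by blast
  qed
qed

section \<open>Selecting one colour by averaging\<close>

text \<open>Relative to \<open>card X\<close>, the quantity \<open>a s * card S\<close> averages to
  1 over the colours and \<open>b s\<close> to at most \<open>\<gamma>\<^sup>2\<close>. Weighting
  the latter by \<open>1 / \<gamma>\<close> lets a single average control size and coverage
  simultaneously.\<close>

lemma exists_balanced_colour:
  fixes F :: "'g \<Rightarrow> 'c" and nb :: "'g \<Rightarrow> 'g set" and \<gamma> :: real
  assumes X: "finite X" "X \<noteq> {}" and S: "finite S" "S \<noteq> {}" and FS: "\<And>G. F G \<in> S" and \<gamma>: "0 < \<gamma>"
    and miss: "(\<Sum>G\<in>X. real (card S) - real (card (F ` nb G))) \<le> \<gamma>\<^sup>2 * card S * card X"
  obtains s where "real (card {G \<in> X. F G = s}) * card S \<le> (1 + \<gamma>) * card X"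
    "real (card {G \<in> X. s \<notin> F ` nb G}) \<le> \<gamma> * (1 + \<gamma>) * card X"
proof -
  define a where "a s = real (card {G \<in> X. F G = s})" for s
  define b where "b s = real (card {G \<in> X. s \<notin> F ` nb G})" for s
  have "(\<Sum>s\<in>S. a s) = (\<Sum>s\<in>S. \<Sum>G\<in>X. of_bool (F G = s))"
    using X(1) by (simp add: a_def Int_def)
  also have "\<dots> = (\<Sum>G\<in>X. \<Sum>s\<in>S. of_bool (F G = s))" by (rule sum.swap)
  also have "\<dots> = (\<Sum>G\<in>X. 1)"
  proof (rule sum.cong)
    fix G assume "G \<in> X"
    have "S \<inter> {s. F G = s} = {F G}" using FS by auto
    then show "(\<Sum>s\<in>S. of_bool (F G = s)) = (1::real)" using S(1) by simp
  qed simp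
  finally have suma: "(\<Sum>s\<in>S. a s) = card X" by simp
  have "(\<Sum>s\<in>S. b s) = (\<Sum>s\<in>S. \<Sum>G\<in>X. of_bool (s \<notin> F ` nb G))"
    using X(1) by (simp add: b_def Int_def)
  also have "\<dots> = (\<Sum>G\<in>X. \<Sum>s\<in>S. of_bool (s \<notin> F ` nb G))" by (rule sum.swap)
  also have "\<dots> = (\<Sum>G\<in>X. real (card S) - real (card (F ` nb G)))"
  proof (rule sum.cong)
    fix G assume "G \<in> X"
    have sub: "F ` nb G \<subseteq> S" using FS by auto
    have "(\<Sum>s\<in>S. of_bool (s \<notin> F ` nb G)) = real (card (S - F ` nb G))"
      using S(1) by (simp add: Diff_eq Compl_eq)
    also have "\<dots> = real (card S) - real (card (F ` nb G))"
      using sub S(1) by (subst card_Diff_subset) (auto simp: of_nat_diff card_mono finite_subset)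
    finally show "(\<Sum>s\<in>S. of_bool (s \<notin> F ` nb G)) = real (card S) - real (card (F ` nb G))" .
  qed simp
  finally have sumb: "(\<Sum>s\<in>S. b s) \<le> \<gamma>\<^sup>2 * card S * card X" using miss by simp
  have "\<exists>s\<in>S. a s * card S + b s / \<gamma> \<le> (1 + \<gamma>) * card X"
  proof (rule ccontr)
    assume "\<not> ?thesis"
    then have "(\<Sum>s\<in>S. (1 + \<gamma>) * card X) < (\<Sum>s\<in>S. a s * card S + b s / \<gamma>)"
      using S by (intro sum_strict_mono) auto
    also have "\<dots> = (\<Sum>s\<in>S. a s) * card S + (\<Sum>s\<in>S. b s) / \<gamma>"
      by (simp add: sum.distrib sum_distrib_right sum_divide_distrib)
    also have "\<dots> \<le> real (card X) * real (card S) + (\<gamma>\<^sup>2 * card S * card X) / \<gamma>"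
      unfolding suma using sumb \<gamma> by (intro add_left_mono divide_right_mono) auto
    also have "\<dots> = (\<Sum>s\<in>S. (1 + \<gamma>) * card X)" using \<gamma> by (simp add: power2_eq_square field_simps)
    finally show False by simp
  qed
  then obtain s where s: "a s * card S + b s / \<gamma> \<le> (1 + \<gamma>) * card X" by blast
  have "0 \<le> a s * card S" "0 \<le> b s / \<gamma>" using \<gamma> by (auto simp: a_def b_def)
  then have "a s * card S \<le> (1 + \<gamma>) * card X" "b s / \<gamma> \<le> (1 + \<gamma>) * card X" using s by linarith+
  then show thesis using that[of s] \<gamma> by (simp add: a_def b_def field_simps)
qed

section \<open>The anti-stochastic property\<close>

definition invariant_properties :: "nat \<Rightarrow> graph set set" where
  "invariant_properties n = {A. A \<subseteq> graphs n \<and>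
     (\<forall>G\<in>graphs n. \<forall>H\<in>graphs n. isomorphic n G H \<longrightarrow> (G \<in> A \<longleftrightarrow> H \<in> A))}"

text \<open>The graphs from which an adversary can reach \<open>A\<close>.\<close>

definition covered :: "nat \<Rightarrow> graph set \<Rightarrow> graph set" where
  "covered n A = {G \<in> graphs n. \<exists>H\<in>A. H \<in> hamming_ball n G}"

text \<open>Three losses, each at most a fraction \<open>\<delta>\<close>: colours missed by the
  labelled code, colours lost to flips that may disturb labels, and graphs without distinct labels,
  for which every colour is given up.\<close>

lemma canonical_colour_total_miss:
  fixes \<delta> :: real and col :: "graph \<Rightarrow> 'c"
  assumes S: "finite S" "\<And>x. col x \<in> S"
    and seen: "\<And>x. x \<subseteq> pairs n \<Longrightarrow> (1 - \<delta>) * card S \<le> real (card (col ` hamming_ball n x))"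
    and shift: "real q * (\<Sum>G\<in>graphs n. card {v \<in> {1..n}. vclass n q c G v \<le> 10}) \<le> 11 * n * card (graphs n)"
    and q: "11 * (real n)\<^sup>2 \<le> \<delta> * q * card S" "0 < q"
    and sep: "real (card {G \<in> graphs n. \<not> separated n q c G}) \<le> \<delta> * card (graphs n)" and \<delta>: "0 \<le> \<delta>"
  shows "(\<Sum>G\<in>graphs n. real (card S) - real (card (canonical_colour n q c col ` hamming_ball n G)))
    \<le> 3 * \<delta> * card S * card (graphs n)"
proof -
  let ?b = "\<lambda>G. card {v \<in> {1..n}. vclass n q c G v \<le> 10}"
  let ?M = "real (card S)"
  have "(\<Sum>G\<in>graphs n. ?M - real (card (canonical_colour n q c col ` hamming_ball n G)))
      \<le> (\<Sum>G\<in>graphs n. \<delta> * ?M + real n * real (?b G) + ?M * of_bool (\<not> separated n q c G))"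
  proof (rule sum_mono)
    fix G assume G: "G \<in> graphs n"
    show "?M - real (card (canonical_colour n q c col ` hamming_ball n G)) \<le>
        \<delta> * ?M + real n * real (?b G) + ?M * of_bool (\<not> separated n q c G)"
    proof (cases "separated n q c G")
      case True
      have "canonical_form n q c G \<subseteq> pairs n"
      proof -
        have "(\<lambda>e. label n q c G ` e) ` pairs n = pairs n"
          using pairs_image[OF label_bij[OF True]] by (simp add: bij_betw_def)
        then show ?thesis using G unfolding canonical_form_def graphs_def by blast
      qed
      then have "(1 - \<delta>) * ?M \<le> real (card (col ` hamming_ball n (canonical_form n q c G)))" by (rule seen)
      also have "\<dots> \<le> real (card (canonical_colour n q c col ` hamming_ball n G) + n * ?b G)"
        by (rule of_nat_mono[OF canonical_colour_seen[OF G True]])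
      finally show ?thesis using True by (simp add: algebra_simps)
    next
      case False
      then have one: "(of_bool (\<not> separated n q c G) :: real) = 1" by simp
      have "0 \<le> \<delta> * ?M" "0 \<le> real n * real (?b G)" using \<delta> by simp_all
      moreover have "0 \<le> real (card (canonical_colour n q c col ` hamming_ball n G))" by simp
      ultimately show ?thesis unfolding one by linarith
    qed
  qed
  also have "\<dots> = \<delta> * ?M * card (graphs n) + real n * real (\<Sum>G\<in>graphs n. ?b G) +
      ?M * real (card {G \<in> graphs n. \<not> separated n q c G})"
    by (simp add: sum.distrib finite_graphs Int_def flip: sum_distrib_left)
  also have "\<dots> \<le> \<delta> * ?M * card (graphs n) + \<delta> * ?M * card (graphs n) + ?M * (\<delta> * card (graphs n))"
  proof (intro add_mono mult_left_mono sep)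
    have "real q * (real n * real (\<Sum>G\<in>graphs n. ?b G)) = real n * (real q * real (\<Sum>G\<in>graphs n. ?b G))" by simp
    also have "\<dots> \<le> real n * (11 * n * card (graphs n))"
      using shift by (intro mult_left_mono) simp_all
    also have "\<dots> = 11 * (real n)\<^sup>2 * card (graphs n)" by (simp add: power2_eq_square)
    also have "\<dots> \<le> (\<delta> * q * ?M) * card (graphs n)" using q(1) by (intro mult_right_mono) simp_all
    finally have "real q * (real n * real (\<Sum>G\<in>graphs n. ?b G)) \<le> real q * (\<delta> * ?M * card (graphs n))"
      by (simp only: ac_simps)
    then show "real n * real (\<Sum>G\<in>graphs n. ?b G) \<le> \<delta> * ?M * card (graphs n)"
      using q(2) by simp
  qed (use \<delta> in auto)
  finally show ?thesis by (simp add: algebra_simps)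
qed

lemma eventually_choose_two:
  assumes "eventually P sequentially"
  shows "\<forall>\<^sub>F n in sequentially. P (n choose 2)"
proof (rule eventually_compose_filterlim[OF assms])
  have "n \<le> n choose 2" if "3 \<le> n" for n
  proof -
    have "n * 2 \<le> n * (n - 1)" using that by (intro mult_le_mono2) simp
    then show ?thesis unfolding choose_two by (subst less_eq_div_iff_mult_less_eq) simp_all
  qed
  then show "filterlim (\<lambda>n. n choose 2) at_top sequentially"
    by (intro filterlim_at_top_mono[OF filterlim_ident] eventually_mono[OF eventually_ge_at_top[of 3]])
qed

lemma exists_small_covering_property:
  fixes \<epsilon> :: real
  assumes \<epsilon>: "0 < \<epsilon>" "\<epsilon> \<le> 1"
  shows "\<forall>\<^sub>F n in sequentially. \<exists>A\<in>invariant_properties n.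
    real (card A) * (real n)\<^sup>2 / 2 \<le> (1 + \<epsilon>) * card (graphs n) \<and>
    (1 - \<epsilon>) * card (graphs n) \<le> real (card (covered n A))"
proof -
  define \<gamma> where "\<gamma> = \<epsilon> / 4"
  \<comment> \<open>The three losses of size \<open>\<delta>\<close> then add up to the
    \<open>\<gamma>\<^sup>2\<close> allowed by the choice of a balanced colour.\<close>
  define \<delta> where "\<delta> = \<gamma>\<^sup>2 / 3"
  have \<gamma>: "0 < \<gamma>" "\<gamma> \<le> 1/4" using \<epsilon> by (simp_all add: \<gamma>_def)
  have "\<gamma> * \<gamma> \<le> \<gamma> * (1/4)" using \<gamma> by (intro mult_left_mono) auto
  then have "\<delta> \<le> \<gamma> / 12" by (simp add: \<delta>_def power2_eq_square)
  then have \<delta>: "0 < \<delta>" "\<delta> < 1/2" "\<delta> \<le> \<epsilon> / 48" using \<gamma> by (auto simp: \<delta>_def \<gamma>_def)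
  \<comment> \<open>At least 10 residues are needed for the classes 1 to 9 to exist. The constant 88
    is 11 times 8: 11 bad classes, and \<open>card S\<close> is at least
    \<open>(real n)\<^sup>2 / 8\<close>.\<close>
  define q where "q = max 10 (nat \<lceil>88 / \<delta>\<rceil>)"
  have q10: "10 \<le> q" by (simp add: q_def)
  have "88 / \<delta> \<le> real q" unfolding q_def by linarith
  then have q: "88 \<le> \<delta> * q" using \<delta>(1) by (simp add: field_simps)
  have codes: "\<forall>\<^sub>F n in sequentially. \<exists>m t s. 0 < m \<and> 0 < t \<and> m * t \<le> 2 ^ s \<and> m * (2 ^ s - 1) \<le> n choose 2 \<and>
    (1 - \<delta>) * real (n choose 2) \<le> real (m * m * t) \<and> (1 - \<delta>) * real (m * m * t) \<le> real (m * t * totient m)"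
    using \<delta> by (intro eventually_choose_two eventually_code_parameters) auto
  have large: "\<forall>\<^sub>F n in sequentially. max 2 (8 / \<epsilon>) \<le> real n"
    using eventually_ge_at_top[of "nat \<lceil>max 2 (8 / \<epsilon>)\<rceil>"] by eventually_elim linarith
  from codes eventually_separated[OF q10 \<delta>(1)] large show ?thesis
  proof eventually_elim
    case (elim n)
    from elim(1) obtain m t s where mts: "0 < m" "0 < t" "m * t \<le> 2 ^ s" "m * (2 ^ s - 1) \<le> n choose 2"
      "(1 - \<delta>) * real (n choose 2) \<le> real (m * m * t)"
      "(1 - \<delta>) * real (m * m * t) \<le> real (m * t * totient m)" by blast
    have n2: "2 \<le> n" using elim(3) by linarith
    have "m * (2 ^ s - 1) \<le> card (pairs n)" using mts(4) by (simp add: card_pairs)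
    from covering_code_exists[OF finite_pairs mts(1,3,2) this]
    obtain col :: "graph \<Rightarrow> int \<times> int \<times> int" where
      col: "\<And>x. col x \<in> {0..<int m} \<times> {0..<int m} \<times> {0..<int t}"
      "\<And>x. x \<subseteq> pairs n \<Longrightarrow> m * t * totient m \<le> card (col ` {y. y \<subseteq> pairs n \<and> card (sym_diff x y) \<le> 1})"
      by blast
    define S where "S = {0..<int m} \<times> {0..<int m} \<times> {0..<int t}"
    have S: "finite S" "card S = m * m * t" by (simp_all add: S_def card_cartesian_product)
    have S_ne: "S \<noteq> {}" using col(1) unfolding S_def by blast
    have seen: "(1 - \<delta>) * card S \<le> real (card (col ` hamming_ball n x))" if "x \<subseteq> pairs n" for x
    proof -
      have "real (m * t * totient m) \<le> real (card (col ` hamming_ball n x))"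
        unfolding hamming_ball_def by (rule of_nat_mono[OF col(2)[OF that]])
      then show ?thesis using mts(6) unfolding S(2) by linarith
    qed
    have n1: "real (n - 1) = real n - 1" using n2 by simp
    have "even (n * (n - 1))" by (cases n) auto
    then have "2 * (n choose 2) = n * (n - 1)" unfolding choose_two by (rule dvd_mult_div_cancel)
    then have "2 * real (n choose 2) = real n * real (n - 1)" by (metis of_nat_mult of_nat_numeral)
    then have N: "real (n choose 2) = real n * (real n - 1) / 2" unfolding n1 by simp
    have SN: "(1 - \<delta>) * (real n * (real n - 1) / 2) \<le> real (card S)" using mts(5) unfolding N S(2) .
    have "(1/2) * (real n * (real n / 2) / 2) \<le> (1 - \<delta>) * (real n * (real n - 1) / 2)"
      using n2 \<delta> by (intro mult_mono divide_right_mono mult_left_mono) auto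
    then have S8: "(real n)\<^sup>2 / 8 \<le> card S" using SN by (simp add: power2_eq_square)
    obtain c where c: "q * (\<Sum>G\<in>graphs n. card {v \<in> {1..n}. vclass n q c G v \<le> 10}) \<le> 11 * n * card (graphs n)"
      using exists_good_shift[of q n] q10 by auto
    define F where "F = canonical_colour n q c col"
    have "(\<Sum>G\<in>graphs n. real (card S) - real (card (F ` hamming_ball n G))) \<le> 3 * \<delta> * card S * card (graphs n)"
      unfolding F_def
    proof (rule canonical_colour_total_miss[OF S(1) _ seen])
      show "col x \<in> S" for x using col(1) by (simp add: S_def)
      have "real (q * (\<Sum>G\<in>graphs n. card {v \<in> {1..n}. vclass n q c G v \<le> 10})) \<le> real (11 * n * card (graphs n))"
        using c by (rule of_nat_mono)
      then show "real q * real (\<Sum>G\<in>graphs n. card {v \<in> {1..n}. vclass n q c G v \<le> 10}) \<le> real (11 * n * card (graphs n))"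
        by (simp only: of_nat_mult)
      have "88 * ((real n)\<^sup>2 / 8) \<le> (\<delta> * q) * card S" using q S8 by (intro mult_mono) auto
      then show "11 * (real n)\<^sup>2 \<le> \<delta> * q * card S" by simp
      show "real (card {G \<in> graphs n. \<not> separated n q c G}) \<le> \<delta> * card (graphs n)" using elim(2) by blast
    qed (use q10 \<delta> in auto)
    then have miss: "(\<Sum>G\<in>graphs n. real (card S) - real (card (F ` hamming_ball n G))) \<le> \<gamma>\<^sup>2 * card S * card (graphs n)"
      by (simp add: \<delta>_def)
    have FS: "F G \<in> S" for G using col(1) by (simp add: F_def canonical_colour_def S_def)
    obtain r where r: "real (card {G \<in> graphs n. F G = r}) * card S \<le> (1 + \<gamma>) * card (graphs n)"
      "real (card {G \<in> graphs n. r \<notin> F ` hamming_ball n G}) \<le> \<gamma> * (1 + \<gamma>) * card (graphs n)"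
      using exists_balanced_colour[OF finite_graphs graphs_nonempty S(1) S_ne FS \<gamma>(1) miss] by blast
    define A where "A = {G \<in> graphs n. F G = r}"
    have "F G = F H" if "isomorphic n G H" "G \<in> graphs n" "H \<in> graphs n" for G H
      unfolding F_def using that by (rule canonical_colour_iso)
    then have "A \<in> invariant_properties n"
      by (auto simp: invariant_properties_def A_def)
    moreover have "real (card A) * (real n)\<^sup>2 / 2 \<le> (1 + \<epsilon>) * card (graphs n)"
    proof -
      have "8 \<le> \<epsilon> * real n" using elim(3) \<epsilon> by (simp add: field_simps)
      then have a: "(1 - \<epsilon> / 8) * real n \<le> real n - 1" by (simp add: algebra_simps)
      \<comment> \<open>The gap between \<open>1 + \<gamma>\<close> and
        \<open>1 + \<epsilon>\<close> pays for the loss \<open>1 - \<delta>\<close> in the number of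
        colours and the loss \<open>1 - \<epsilon> / 8\<close> from replacing \<open>n - 1\<close>
        by \<open>n\<close>.\<close>
      have "1 + \<gamma> \<le> (1 + \<epsilon>) * (1 - \<epsilon> / 4)"
      proof -
        have "\<epsilon> * \<epsilon> \<le> \<epsilon> * 1" using \<epsilon> by (intro mult_left_mono) auto
        then show ?thesis using \<epsilon>(1) by (simp add: \<gamma>_def field_simps)
      qed
      also have "\<dots> \<le> (1 + \<epsilon>) * ((1 - \<delta>) * (1 - \<epsilon> / 8))"
      proof (intro mult_left_mono)
        have "0 \<le> \<delta> * \<epsilon>" using \<delta> \<epsilon> by simp
        moreover have "(1 - \<delta>) * (1 - \<epsilon> / 8) = 1 - \<delta> - \<epsilon> / 8 + \<delta> * \<epsilon> / 8" by (simp add: field_simps)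
        ultimately show "1 - \<epsilon> / 4 \<le> (1 - \<delta>) * (1 - \<epsilon> / 8)" using \<delta>(3) \<epsilon>(1) by linarith
      qed (use \<epsilon> in auto)
      finally have g: "1 + \<gamma> \<le> (1 + \<epsilon>) * ((1 - \<delta>) * (1 - \<epsilon> / 8))" .
      have "(1 - \<delta>) * (1 - \<epsilon> / 8) * ((real n)\<^sup>2 / 2) = (1 - \<delta>) * (real n * ((1 - \<epsilon> / 8) * real n) / 2)"
        by (simp add: power2_eq_square)
      also have "\<dots> \<le> (1 - \<delta>) * (real n * (real n - 1) / 2)"
        using \<delta> by (intro mult_left_mono divide_right_mono a) auto
      also note SN
      finally have "real (card A) * ((1 - \<delta>) * (1 - \<epsilon> / 8) * ((real n)\<^sup>2 / 2)) \<le> real (card A) * card S"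
        by (intro mult_left_mono) auto
      also have "\<dots> \<le> (1 + \<gamma>) * card (graphs n)" using r(1) by (simp add: A_def)
      also have "\<dots> \<le> (1 + \<epsilon>) * ((1 - \<delta>) * (1 - \<epsilon> / 8)) * card (graphs n)"
        using g by (intro mult_right_mono) auto
      finally have "((1 - \<delta>) * (1 - \<epsilon> / 8)) * (real (card A) * (real n)\<^sup>2 / 2) \<le> ((1 - \<delta>) * (1 - \<epsilon> / 8)) * ((1 + \<epsilon>) * card (graphs n))"
        by (simp add: ac_simps)
      moreover have "0 < (1 - \<delta>) * (1 - \<epsilon> / 8)" using \<delta> \<epsilon> by (intro mult_pos_pos) auto
      ultimately show ?thesis by (rule mult_left_le_imp_le)
    qed
    moreover have "(1 - \<epsilon>) * card (graphs n) \<le> real (card (covered n A))"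
    proof -
      have "graphs n \<subseteq> covered n A \<union> {G \<in> graphs n. r \<notin> F ` hamming_ball n G}"
        by (auto simp: covered_def A_def graphs_def hamming_ball_def)
      then have "card (graphs n) \<le> card (covered n A \<union> {G \<in> graphs n. r \<notin> F ` hamming_ball n G})"
        by (intro card_mono) (auto simp: covered_def finite_graphs)
      also have "\<dots> \<le> card (covered n A) + card {G \<in> graphs n. r \<notin> F ` hamming_ball n G}" by (rule card_Un_le)
      finally have "real (card (graphs n)) \<le> real (card (covered n A)) + real (card {G \<in> graphs n. r \<notin> F ` hamming_ball n G})"
        unfolding of_nat_add[symmetric] by (rule of_nat_mono)
      also have "\<dots> \<le> real (card (covered n A)) + \<gamma> * (1 + \<gamma>) * card (graphs n)" using r(2) by simp
      also have "\<dots> \<le> real (card (covered n A)) + \<epsilon> * card (graphs n)"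
      proof (intro add_left_mono mult_right_mono)
        have "\<gamma> * (1 + \<gamma>) \<le> \<gamma> * 2" using \<gamma> by (intro mult_left_mono) auto
        then show "\<gamma> * (1 + \<gamma>) \<le> \<epsilon>" using \<epsilon> by (simp add: \<gamma>_def)
      qed auto
      finally show ?thesis by (simp add: algebra_simps)
    qed
    ultimately show ?case by blast
  qed
qed

section \<open>Matching lower bound on density and the optimal property\<close>

text \<open>Distance one is symmetric, so each member of \<open>A\<close> covers itself and at most
  one graph per vertex pair.\<close>

lemma card_covered_le:
  assumes "A \<subseteq> graphs n"
  shows "card (covered n A) \<le> card A * Suc (n choose 2)"
proof -
  have finA: "finite A" using assms finite_graphs finite_subset by blast
  let ?N = "\<lambda>H. insert H ((\<lambda>e. sym_diff H {e}) ` pairs n)"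
  have "covered n A \<subseteq> (\<Union>H\<in>A. ?N H)"
  proof
    fix G assume "G \<in> covered n A"
    then obtain H where H: "H \<in> A" "G \<subseteq> pairs n" "H \<subseteq> pairs n" "card (sym_diff G H) \<le> 1"
      by (auto simp: covered_def hamming_ball_def graphs_def)
    have fin: "finite (sym_diff G H)"
      using H(2,3) finite_pairs by (meson finite_Diff finite_UnI finite_subset)
    have "G \<in> ?N H"
    proof (cases "sym_diff G H = {}")
      case True
      then have "G = H" by blast
      then show ?thesis by simp
    next
      case False
      then have "card (sym_diff G H) = 1" using H(4) fin
        by (metis card_0_eq less_one linorder_le_less_linear order_antisym)
      then obtain e where e: "sym_diff G H = {e}" by (metis card_1_singletonE)
      then have "e \<in> pairs n" "G = sym_diff H {e}" using H(2,3) by blast+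
      then show ?thesis by blast
    qed
    then show "G \<in> (\<Union>H\<in>A. ?N H)" using H(1) by blast
  qed
  then have "card (covered n A) \<le> card (\<Union>H\<in>A. ?N H)"
    using finA by (intro card_mono) (auto simp: finite_pairs)
  also have "\<dots> \<le> (\<Sum>H\<in>A. card (?N H))" using finA by (rule card_UN_le)
  also have "\<dots> \<le> (\<Sum>H\<in>A. Suc (n choose 2))"
  proof (rule sum_mono)
    fix H
    have "card (?N H) \<le> Suc (card ((\<lambda>e. sym_diff H {e}) ` pairs n))" by (rule card_insert_le_m1) simp_all
    also have "\<dots> \<le> Suc (n choose 2)"
      using card_image_le[OF finite_pairs, of "\<lambda>e. sym_diff H {e}" n] by (simp add: card_pairs)
    finally show "card (?N H) \<le> Suc (n choose 2)" .
  qed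
  finally show ?thesis by simp
qed

lemma prob_random_graph:
  "measure_pmf.prob (random_graph n) X = real (card (graphs n \<inter> X)) / card (graphs n)"
  by (simp add: random_graph_def measure_pmf_of_set graphs_nonempty finite_graphs)

text \<open>One number bounds both the relative excess of the density over
  \<open>2 / n\<^sup>2\<close> and the uncovered fraction, so a single minimisation handles
  both.\<close>

definition excess :: "nat \<Rightarrow> graph set \<Rightarrow> real" where
  "excess n A = max (real (card A) / card (graphs n) * (real n)\<^sup>2 / 2 - 1)
     (1 - real (card (covered n A)) / card (graphs n))"

text \<open>
  Since minimisers are at least as good as the properties found for each fixed error bound, no
  diagonal sequence of error bounds is needed.
\<close>

definition best_property :: "nat \<Rightarrow> graph set" where
  "best_property n = arg_min_on (excess n) (invariant_properties n)"

lemma finite_invariant_properties: "finite (invariant_properties n)"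
  by (rule finite_subset[of _ "Pow (graphs n)"]) (auto simp: invariant_properties_def finite_graphs)

lemma invariant_properties_nonempty: "invariant_properties n \<noteq> {}"
  by (auto simp: invariant_properties_def)

lemma best_property_invariant: "best_property n \<in> invariant_properties n"
  unfolding best_property_def
  by (rule arg_min_if_finite(1)[OF finite_invariant_properties invariant_properties_nonempty])

lemma eventually_excess_le:
  assumes "0 < \<epsilon>"
  shows "\<forall>\<^sub>F n in sequentially. excess n (best_property n) \<le> \<epsilon>"
proof -
  define e where "e = min \<epsilon> 1"
  have "0 < e" "e \<le> 1" using assms by (auto simp: e_def)
  from exists_small_covering_property[OF this] show ?thesis
  proof eventually_elim
    case (elim n)
    then obtain A where A: "A \<in> invariant_properties n"
      "real (card A) * (real n)\<^sup>2 / 2 \<le> (1 + e) * card (graphs n)"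
      "(1 - e) * card (graphs n) \<le> real (card (covered n A))" by blast
    have pos: "0 < real (card (graphs n))" by (simp add: card_graphs)
    have "real (card A) / card (graphs n) * (real n)\<^sup>2 / 2 \<le> 1 + e" "1 - e \<le> real (card (covered n A)) / card (graphs n)"
      using A(2,3) pos by (simp_all add: field_simps)
    then have "excess n A \<le> e" by (simp add: excess_def)
    moreover have "excess n (best_property n) \<le> excess n A"
      unfolding best_property_def
      by (rule arg_min_least[OF finite_invariant_properties invariant_properties_nonempty A(1)])
    ultimately show ?case by (simp add: e_def)
  qed
qed

text \<open>The size \<open>(n choose 2) + 1\<close> of a ball is at most
  \<open>n\<^sup>2 / 2\<close> as soon as \<open>n\<close> is at least 2.\<close>

lemma coverage_le_density:
  assumes "A \<subseteq> graphs n" "2 \<le> n"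
  shows "real (card (covered n A)) / card (graphs n) \<le> real (card A) / card (graphs n) * (real n)\<^sup>2 / 2"
proof -
  have "n * (n - 1) + 2 \<le> n * n" using assms(2) by (cases n) auto
  then have "2 * Suc (n choose 2) \<le> n * n"
    by (simp add: choose_two)
  then have "2 * real (Suc (n choose 2)) \<le> (real n)\<^sup>2"
    by (metis of_nat_le_iff of_nat_mult of_nat_numeral power2_eq_square)
  then have "real (card A) * real (Suc (n choose 2)) \<le> real (card A) * ((real n)\<^sup>2 / 2)"
    by (intro mult_left_mono) auto
  moreover have "real (card (covered n A)) \<le> real (card A) * real (Suc (n choose 2))"
    using of_nat_mono[OF card_covered_le[OF assms(1)], where 'a = real] by (simp only: of_nat_mult)
  ultimately have "real (card (covered n A)) \<le> real (card A) * ((real n)\<^sup>2 / 2)" by (rule order_trans[rotated])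
  then show ?thesis by (simp add: card_graphs field_simps)
qed

theorem theorem1:
  shows "\<exists>A. graph_property A \<and> iso_invariant A \<and> anti_stochastic A \<and>
           (\<exists>\<epsilon> :: nat \<Rightarrow> real. \<epsilon> \<in> o(\<lambda>_. 1) \<and>
              (\<forall>n\<ge>1. measure_pmf.prob (random_graph n) (A n) = (2 + \<epsilon> n) / (real n)\<^sup>2))"
proof (intro exI[of _ best_property] conjI)
  let ?A = best_property
  have sub: "?A n \<subseteq> graphs n" for n
    using best_property_invariant[of n] by (simp add: invariant_properties_def)
  then show "graph_property ?A" by (simp add: graph_property_def)
  show "iso_invariant ?A"
    unfolding iso_invariant_def using best_property_invariant by (auto simp: invariant_properties_def)
  define p where "p n = measure_pmf.prob (random_graph n) (?A n)" for n
  define cov where "cov n = real (card (covered n (?A n))) / card (graphs n)" for n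
  define \<epsilon> where "\<epsilon> n = p n * (real n)\<^sup>2 - 2" for n
  have p: "p n = real (card (?A n)) / card (graphs n)" for n
    using sub[of n] by (simp add: p_def prob_random_graph Int_absorb1)
  have ex: "excess n (?A n) = max (p n * (real n)\<^sup>2 / 2 - 1) (1 - cov n)" for n
    by (simp add: excess_def p cov_def)
  have cov_le1: "cov n \<le> 1" for n
  proof -
    have "card (covered n (?A n)) \<le> card (graphs n)"
      by (intro card_mono finite_graphs) (auto simp: covered_def)
    then show ?thesis by (simp add: cov_def divide_le_eq_1 card_graphs)
  qed
  have cov_lim: "(\<lambda>n. 1 - cov n) \<longlonglongrightarrow> 0"
  proof (rule tendstoI)
    fix e :: real assume "0 < e"
    then have "0 < e / 2" by simp
    from eventually_excess_le[OF this] show "\<forall>\<^sub>F n in sequentially. dist (1 - cov n) 0 < e"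
    proof eventually_elim
      case (elim n)
      then have "1 - cov n \<le> e / 2" unfolding ex by (rule max.boundedE)
      then show ?case using cov_le1[of n] \<open>0 < e\<close> by (simp add: dist_real_def)
    qed
  qed
  have \<epsilon>_lim: "\<epsilon> \<longlonglongrightarrow> 0"
  proof (rule tendstoI)
    fix e :: real assume "0 < e"
    then have "0 < e / 4" by simp
    from eventually_excess_le[OF this] eventually_ge_at_top[of 2] show "\<forall>\<^sub>F n in sequentially. dist (\<epsilon> n) 0 < e"
    proof eventually_elim
      case (elim n)
      then have "p n * (real n)\<^sup>2 / 2 - 1 \<le> e / 4" "1 - cov n \<le> e / 4"
        unfolding ex max.bounded_iff by blast+
      \<comment> \<open>Lower half of the estimate: almost full coverage keeps the density from
        falling below \<open>2 / n\<^sup>2\<close> by more than a small fraction.\<close>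
      moreover have "cov n \<le> p n * (real n)\<^sup>2 / 2"
        using coverage_le_density[OF sub elim(2)] by (simp add: cov_def p)
      ultimately have "\<bar>\<epsilon> n\<bar> \<le> e / 2" unfolding \<epsilon>_def by linarith
      then show ?case using \<open>0 < e\<close> by (simp add: dist_real_def)
    qed
  qed
  have p_eq: "p n = (2 + \<epsilon> n) / (real n)\<^sup>2" if "1 \<le> n" for n
    using that by (simp add: \<epsilon>_def)
  show "\<exists>\<epsilon> :: nat \<Rightarrow> real. \<epsilon> \<in> o(\<lambda>_. 1) \<and>
      (\<forall>n\<ge>1. measure_pmf.prob (random_graph n) (?A n) = (2 + \<epsilon> n) / (real n)\<^sup>2)"
    using \<epsilon>_lim p_eq by (intro exI[of _ \<epsilon>] conjI smalloI_tendsto) (auto simp: p_def)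
  have "(\<lambda>n. (2 + \<epsilon> n) * (1 / (real n)\<^sup>2)) \<longlonglongrightarrow> (2 + 0) * 0"
    by (intro tendsto_mult tendsto_add tendsto_const \<epsilon>_lim) real_asymp
  then have "(\<lambda>n. (2 + \<epsilon> n) / (real n)\<^sup>2) \<longlonglongrightarrow> 0" by simp
  moreover have "\<forall>\<^sub>F n in sequentially. (2 + \<epsilon> n) / (real n)\<^sup>2 = p n"
    using eventually_ge_at_top[of 1] by eventually_elim (simp add: p_eq)
  ultimately have p_lim: "p \<longlonglongrightarrow> 0" by (rule Lim_transform_eventually)
  \<comment> \<open>Leaving \<open>G\<close> alone when no member of the property is within reach
    keeps \<open>f\<close> an adversary on every graph.\<close>
  define f where "f n G = (if \<exists>H\<in>?A n. H \<in> hamming_ball n G then SOME H. H \<in> ?A n \<and> H \<in> hamming_ball n G else G)" for n G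
  have f_in: "f n G \<in> ?A n \<and> f n G \<in> hamming_ball n G" if "\<exists>H\<in>?A n. H \<in> hamming_ball n G" for n G
    unfolding f_def using that someI_ex[of "\<lambda>H. H \<in> ?A n \<and> H \<in> hamming_ball n G"] by auto
  have "adversary f"
    unfolding adversary_def
  proof (intro allI ballI)
    fix n G assume G: "G \<in> graphs n"
    have "f n G \<in> hamming_ball n G"
    proof (cases "\<exists>H\<in>?A n. H \<in> hamming_ball n G")
      case False
      then have "f n G = G" unfolding f_def by (rule if_not_P)
      then show ?thesis using G by (simp add: hamming_ball_def graphs_def)
    qed (use f_in in blast)
    then show "f n G \<in> graphs n \<and> card ((G - f n G) \<union> (f n G - G)) \<le> 1"
      by (auto simp: hamming_ball_def graphs_def)
  qed
  moreover have "(\<lambda>n. 1 - measure_pmf.prob (random_graph n) {G. f n G \<in> ?A n}) \<in> o(\<lambda>_. 1)"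
  proof (rule smalloI_tendsto)
    have "(\<lambda>n. 1 - measure_pmf.prob (random_graph n) {G. f n G \<in> ?A n}) \<longlonglongrightarrow> 0"
    proof (rule real_tendsto_sandwich[OF _ _ tendsto_const cov_lim])
      show "\<forall>\<^sub>F n in sequentially. 0 \<le> 1 - measure_pmf.prob (random_graph n) {G. f n G \<in> ?A n}"
        by simp
      have "cov n \<le> measure_pmf.prob (random_graph n) {G. f n G \<in> ?A n}" for n
      proof -
        have "covered n (?A n) \<subseteq> graphs n \<inter> {G. f n G \<in> ?A n}"
          using f_in by (auto simp: covered_def)
        then have "card (covered n (?A n)) \<le> card (graphs n \<inter> {G. f n G \<in> ?A n})"
          by (intro card_mono) (simp_all add: finite_graphs)
        then show ?thesis unfolding cov_def prob_random_graph by (intro divide_right_mono) simp_all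
      qed
      then show "\<forall>\<^sub>F n in sequentially. 1 - measure_pmf.prob (random_graph n) {G. f n G \<in> ?A n} \<le> 1 - cov n"
        by simp
    qed
    then show "(\<lambda>n. (1 - measure_pmf.prob (random_graph n) {G. f n G \<in> ?A n}) / 1) \<longlonglongrightarrow> 0" by simp
  qed simp
  moreover have "(\<lambda>n. measure_pmf.prob (random_graph n) (?A n)) \<in> o(\<lambda>_. 1)"
    using p_lim by (intro smalloI_tendsto) (simp_all add: p_def[abs_def])
  ultimately show "anti_stochastic ?A" unfolding anti_stochastic_def by blast
qed

end
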